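(* Let $(\mathbb{R}^n,g)$ be a pseudo-Euclidean space, $n\ge 3$, with coordinates $x=(x_1,\dots,x_n)$ and $g_{ij}=\delta_{ij}\varepsilon_i$, $\varepsilon_i\in\{-1,1\}$. Let $M=(\mathbb{R}^n,\bar g)\times_f F^m$ be a warped product, where $\bar g=\frac{1}{\varphi^2}g$, $F$ is a scalar-flat semi-Riemannian manifold of dimension $m\ge 1$, and $f,\varphi,h:\mathbb{R}^n\to\mathbb{R}$ are smooth functions with $f>0$ which are functions $f(\xi),\varphi(\xi),h(\xi)$ of $\xi=\sum_{k=1}^n\alpha_kx_k$, where $\alpha_k\in\mathbb{R}$, $(\alpha_1,\dots,\alpha_n)\ne0$ and $\sum_{k=1}^n\varepsilon_k\alpha_k^2=0$. Then, given smooth functions $\varphi(\xi)$ and $f(\xi)$, the warped product metric $\tilde g=\bar g\oplus f^2g_F$ is a steady gradient Yamabe soliton with potential function $h$ if and only if $$h(\xi)=\alpha\int\frac{1}{\varphi^2(\xi)}\,d\xi$$ for some constant $\alpha\in\mathbb{R}$.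
   Context: A pseudo-Riemannian manifold $(M,g)$ is a gradient Yamabe soliton with potential function $h$ if there is a real constant $\rho$ with $(S_g-\rho)g=\mathrm{Hess}_g(h)$, where $S_g$ is the scalar curvature; it is steady if $\rho=0$, i.e. $S_g\,g=\mathrm{Hess}_g(h)$. The warped product $B\times_f F$ is $B\times F$ with metric $\tilde g=g_B\oplus f^2g_F$. Scalar-flat means scalar curvature identically zero. The function $h$ on $\mathbb{R}^n$ is regarded as a function on $M=\mathbb{R}^n\times F$ by composing with the projection to $\mathbb{R}^n$. Since $\bar g=\frac1{\varphi^2}g$ must be a metric, $\varphi$ is nowhere zero. The integral is an indefinite integral (an antiderivative, determined up to an additive constant), so the condition says $h'(\xi)=\alpha/\varphi^2(\xi)$, with $'$ the derivative with respect to $\xi$. *)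

theory Defs
  imports "HOL-Analysis.Analysis"
begin

section \<open>Smooth functions on open sets\<close>

primrec Ck_on :: "nat \<Rightarrow> 'a::real_normed_vector set \<Rightarrow> ('a \<Rightarrow> 'b::real_normed_vector) \<Rightarrow> bool" where
  "Ck_on 0 S u \<longleftrightarrow> continuous_on S u"
| "Ck_on (Suc k) S u \<longleftrightarrow>
     (\<forall>x\<in>S. u differentiable (at x)) \<and> (\<forall>v. Ck_on k S (\<lambda>x. frechet_derivative u (at x) v))"

definition smooth_on :: "'a::real_normed_vector set \<Rightarrow> ('a \<Rightarrow> 'b::real_normed_vector) \<Rightarrow> bool" where
  "smooth_on S u \<longleftrightarrow> (\<forall>k. Ck_on k S u)"

definition partial :: "'i::finite \<Rightarrow> (real^'i \<Rightarrow> real) \<Rightarrow> real^'i \<Rightarrow> real" where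
  "partial i u y = frechet_derivative u (at y) (axis i 1)"

section \<open>Semi-Riemannian manifolds\<close>

text \<open>A smooth manifold of dimension \<open>CARD('i)\<close> is given by a topology together with a smooth atlas,
  i.e. a family of charts indexed by \<open>chart_ix\<close>. The metric is given, in the classical way, by its
  matrix of components in each chart: \<open>metric_tensor M a y\<close> is the matrix \<open>(g\<^sub>i\<^sub>j)\<close> in chart \<open>a\<close> at the
  point whose coordinates are \<open>y\<close>. Its values for \<open>y\<close> outside the image of the chart are irrelevant.\<close>

record ('p, 'c, 'i::finite) metric_manifold =
  mtop :: "'p topology"
  chart_ix :: "'c set"
  chart_dom :: "'c \<Rightarrow> 'p set"
  chart_map :: "'c \<Rightarrow> 'p \<Rightarrow> real^'i"
  metric_tensor :: "'c \<Rightarrow> real^'i \<Rightarrow> real^'i^'i"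

definition chart_image :: "('p, 'c, 'i::finite) metric_manifold \<Rightarrow> 'c \<Rightarrow> (real^'i) set" where
  "chart_image M a = chart_map M a ` chart_dom M a"

definition chart_inv :: "('p, 'c, 'i::finite) metric_manifold \<Rightarrow> 'c \<Rightarrow> real^'i \<Rightarrow> 'p" where
  "chart_inv M a = inv_into (chart_dom M a) (chart_map M a)"

definition transition :: "('p, 'c, 'i::finite) metric_manifold \<Rightarrow> 'c \<Rightarrow> 'c \<Rightarrow> real^'i \<Rightarrow> real^'i" where
  "transition M a b = chart_map M b \<circ> chart_inv M a"

definition overlap :: "('p, 'c, 'i::finite) metric_manifold \<Rightarrow> 'c \<Rightarrow> 'c \<Rightarrow> (real^'i) set" where
  "overlap M a b = chart_map M a ` (chart_dom M a \<inter> chart_dom M b)"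

text \<open>Manifolds are taken to be nonempty; they need not be connected.\<close>

definition smooth_manifold :: "('p, 'c, 'i::finite) metric_manifold \<Rightarrow> bool" where
  "smooth_manifold M \<longleftrightarrow>
     topspace (mtop M) \<noteq> {} \<and> Hausdorff_space (mtop M) \<and> second_countable (mtop M) \<and>
     topspace (mtop M) = (\<Union>a\<in>chart_ix M. chart_dom M a) \<and>
     (\<forall>a\<in>chart_ix M. openin (mtop M) (chart_dom M a) \<and> open (chart_image M a) \<and>
        homeomorphic_map (subtopology (mtop M) (chart_dom M a)) (top_of_set (chart_image M a))
          (chart_map M a)) \<and>
     (\<forall>a\<in>chart_ix M. \<forall>b\<in>chart_ix M. smooth_on (overlap M a b) (transition M a b))"

definition diag_matrix :: "real^'i \<Rightarrow> real^'i^'i::finite" where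
  "diag_matrix d = (\<chi> i j. if i = j then d $ i else 0)"

text \<open>The index is the number of minus signs in an orthonormal basis (the columns of \<open>P\<close>);
  by Sylvester's law it does not depend on the basis.\<close>

definition has_index :: "real^'i^'i::finite \<Rightarrow> nat \<Rightarrow> bool" where
  "has_index G q \<longleftrightarrow>
     (\<exists>(P :: real^'i^'i) (e :: real^'i). invertible P \<and> (\<forall>i. e $ i \<in> {-1, 1}) \<and>
        transpose P ** G ** P = diag_matrix e \<and> card {i. e $ i = -1} = q)"

definition semi_riemannian :: "('p, 'c, 'i::finite) metric_manifold \<Rightarrow> bool" where
  "semi_riemannian M \<longleftrightarrow>
     smooth_manifold M \<and>
     (\<forall>a\<in>chart_ix M. \<forall>i j. smooth_on (chart_image M a) (\<lambda>y. metric_tensor M a y $ i $ j)) \<and>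
     (\<forall>a\<in>chart_ix M. \<forall>b\<in>chart_ix M. \<forall>y\<in>overlap M a b.
        let J = matrix (frechet_derivative (transition M a b) (at y)) in
          metric_tensor M a y = transpose J ** metric_tensor M b (transition M a b y) ** J) \<and>
     (\<forall>a\<in>chart_ix M. \<forall>y\<in>chart_image M a.
        transpose (metric_tensor M a y) = metric_tensor M a y \<and> invertible (metric_tensor M a y)) \<and>
     (\<exists>q. \<forall>a\<in>chart_ix M. \<forall>y\<in>chart_image M a. has_index (metric_tensor M a y) q)"

definition smooth_function :: "('p, 'c, 'i::finite) metric_manifold \<Rightarrow> ('p \<Rightarrow> real) \<Rightarrow> bool" where
  "smooth_function M u \<longleftrightarrow> (\<forall>a\<in>chart_ix M. smooth_on (chart_image M a) (u \<circ> chart_inv M a))"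

section \<open>Curvature and Hessian in local coordinates\<close>

text \<open>Here \<open>G\<close> is the component matrix of a metric as a function of the coordinates;
  \<open>christoffel G k i j\<close> is \<open>\<Gamma>\<^sup>k\<^sub>i\<^sub>j\<close> of the Levi-Civita connection. The sign convention
  is that round spheres have positive scalar curvature.\<close>

definition christoffel :: "(real^'i \<Rightarrow> real^'i^'i::finite) \<Rightarrow> 'i \<Rightarrow> 'i \<Rightarrow> 'i \<Rightarrow> real^'i \<Rightarrow> real" where
  "christoffel G k i j y =
     1/2 * (\<Sum>l\<in>UNIV. matrix_inv (G y) $ k $ l *
       (partial i (\<lambda>z. G z $ j $ l) y + partial j (\<lambda>z. G z $ i $ l) y - partial l (\<lambda>z. G z $ i $ j) y))"

definition ricci :: "(real^'i \<Rightarrow> real^'i^'i::finite) \<Rightarrow> 'i \<Rightarrow> 'i \<Rightarrow> real^'i \<Rightarrow> real" where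
  "ricci G i j y =
     (\<Sum>k\<in>UNIV. partial k (christoffel G k i j) y - partial j (christoffel G k i k) y
       + (\<Sum>l\<in>UNIV. christoffel G k k l y * christoffel G l i j y
                  - christoffel G k j l y * christoffel G l i k y))"

definition scalar_curv :: "(real^'i \<Rightarrow> real^'i^'i::finite) \<Rightarrow> real^'i \<Rightarrow> real" where
  "scalar_curv G y = (\<Sum>i\<in>UNIV. \<Sum>j\<in>UNIV. matrix_inv (G y) $ i $ j * ricci G i j y)"

definition hessian ::
    "(real^'i \<Rightarrow> real^'i^'i::finite) \<Rightarrow> (real^'i \<Rightarrow> real) \<Rightarrow> 'i \<Rightarrow> 'i \<Rightarrow> real^'i \<Rightarrow> real" where
  "hessian G u i j y =
     partial i (partial j u) y - (\<Sum>k\<in>UNIV. christoffel G k i j y * partial k u y)"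

definition scalar_flat :: "('p, 'c, 'i::finite) metric_manifold \<Rightarrow> bool" where
  "scalar_flat M \<longleftrightarrow>
     (\<forall>a\<in>chart_ix M. \<forall>y\<in>chart_image M a. scalar_curv (metric_tensor M a) y = 0)"

definition gradient_yamabe_soliton ::
    "('p, 'c, 'i::finite) metric_manifold \<Rightarrow> ('p \<Rightarrow> real) \<Rightarrow> real \<Rightarrow> bool" where
  "gradient_yamabe_soliton M h \<rho> \<longleftrightarrow>
     semi_riemannian M \<and> smooth_function M h \<and>
     (\<forall>a\<in>chart_ix M. \<forall>y\<in>chart_image M a. \<forall>i j.
        (scalar_curv (metric_tensor M a) y - \<rho>) * metric_tensor M a y $ i $ j
          = hessian (metric_tensor M a) (h \<circ> chart_inv M a) i j y)"

definition steady_gradient_yamabe_soliton ::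
    "('p, 'c, 'i::finite) metric_manifold \<Rightarrow> ('p \<Rightarrow> real) \<Rightarrow> bool" where
  "steady_gradient_yamabe_soliton M h \<longleftrightarrow> gradient_yamabe_soliton M h 0"

section \<open>Pseudo-Euclidean space, conformal metrics, warped products\<close>

definition pseudo_euclidean :: "real^'n \<Rightarrow> (real^'n, unit, 'n::finite) metric_manifold" where
  "pseudo_euclidean \<epsilon> =
     \<lparr>mtop = euclidean, chart_ix = UNIV, chart_dom = (\<lambda>_. UNIV), chart_map = (\<lambda>_ x. x),
      metric_tensor = (\<lambda>_ _. diag_matrix \<epsilon>)\<rparr>"

definition conformal_metric ::
    "('p \<Rightarrow> real) \<Rightarrow> ('p, 'c, 'i::finite) metric_manifold \<Rightarrow> ('p, 'c, 'i) metric_manifold" where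
  "conformal_metric u M =
     M\<lparr>metric_tensor := (\<lambda>a y. u (chart_inv M a y) *\<^sub>R metric_tensor M a y)\<rparr>"

text \<open>Coordinates on a product are indexed by the sum type: \<open>Inl\<close> for the base, \<open>Inr\<close> for the fibre.\<close>

definition vec_join :: "real^'b \<Rightarrow> real^'m \<Rightarrow> real^('b::finite + 'm::finite)" where
  "vec_join x y = (\<chi> k. case k of Inl i \<Rightarrow> x $ i | Inr j \<Rightarrow> y $ j)"

definition vec_left :: "real^('b::finite + 'm::finite) \<Rightarrow> real^'b" where
  "vec_left z = (\<chi> i. z $ Inl i)"

definition vec_right :: "real^('b::finite + 'm::finite) \<Rightarrow> real^'m" where
  "vec_right z = (\<chi> j. z $ Inr j)"

definition block_diag :: "real^'b^'b \<Rightarrow> real^'m^'m \<Rightarrow> real^('b::finite + 'm::finite)^('b + 'm)" where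
  "block_diag A D = (\<chi> k l. case (k, l) of
       (Inl i, Inl j) \<Rightarrow> A $ i $ j
     | (Inr i, Inr j) \<Rightarrow> D $ i $ j
     | _ \<Rightarrow> 0)"

definition warped_product ::
    "('p, 'c, 'b::finite) metric_manifold \<Rightarrow> ('p \<Rightarrow> real) \<Rightarrow> ('q, 'd, 'm::finite) metric_manifold
      \<Rightarrow> ('p \<times> 'q, 'c \<times> 'd, 'b + 'm) metric_manifold" where
  "warped_product B f F =
     \<lparr>mtop = prod_topology (mtop B) (mtop F),
      chart_ix = chart_ix B \<times> chart_ix F,
      chart_dom = (\<lambda>(a, b). chart_dom B a \<times> chart_dom F b),
      chart_map = (\<lambda>(a, b) (p, q). vec_join (chart_map B a p) (chart_map F b q)),
      metric_tensor = (\<lambda>(a, b) z. block_diag (metric_tensor B a (vec_left z))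
        ((f (chart_inv B a (vec_left z)))\<^sup>2 *\<^sub>R metric_tensor F b (vec_right z)))\<rparr>"

end

theory Submission
  imports Defs
begin

text \<open>
  Write the metric of the warped product in a product chart as
  \<open>u(\<xi>) \<epsilon> \<oplus> w(\<xi>) \<gamma>\<close>, where \<open>u = 1/\<phi>\<^sup>2\<close>, \<open>w = f\<^sup>2\<close>, \<open>\<xi> = \<alpha> \<bullet> x\<close> and \<open>\<gamma>\<close> is the
  fibre metric. The theorem holds because \<open>\<alpha>\<close> is a null covector: contracting \<open>d\<xi>\<close> with itself in
  \<open>\<epsilon>\<close> gives \<open>\<Sum>\<^sub>k \<epsilon>\<^sub>k \<alpha>\<^sub>k\<^sup>2 = 0\<close>, and almost every curvature term contains this contraction.

  Two consequences carry the proof. First, the Ricci tensor on base directions is a multiple of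
  \<open>\<alpha>\<^sub>i \<alpha>\<^sub>j\<close>, whose trace vanishes, and on fibre directions it is the Ricci tensor of \<open>\<gamma>\<close>
  (\<open>ricci_G_Inl\<close>, \<open>ricci_G_Inr\<close>). Hence the scalar curvature is that of \<open>\<gamma>\<close> divided by \<open>w\<close>
  (\<open>scalar_curv_G\<close>), and it vanishes for a scalar-flat fibre.
  The steady soliton equation therefore reduces to \<open>Hess h = 0\<close>. Secondly, the fibre and mixed components of the
  Hessian of a function of \<open>\<xi>\<close> vanish, and its base components are
  \<open>(h'' - (u'/u) h') \<alpha>\<^sub>i \<alpha>\<^sub>j\<close> (\<open>hessian_G\<close>). Since \<open>\<alpha> \<noteq> 0\<close> and \<open>\<xi>\<close> takes every real value in a
  product chart, the equation says that \<open>h'/u\<close> is constant (\<open>deriv_proportional_iff\<close>), which is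
  \<open>h' = c/\<phi>\<^sup>2\<close>.

  Being a soliton also includes that the warped product is a semi-Riemannian manifold and that \<open>h\<close> is
  smooth on it. This is shown for arbitrary semi-Riemannian base and fibre
  (\<open>semi_riemannian_warped_product\<close>, \<open>smooth_function_warped_product_base\<close>), from closure properties of smooth
  functions. Smoothness is also used in the curvature computation: a partial derivative of a fibre
  Christoffel symbol can be pulled back to the product only when that symbol is differentiable,
  which rests on Cramer's rule for the inverse matrix.
\<close>

section \<open>Smooth functions\<close>

lemma Ck_on_cong:
  assumes "open S" and "\<And>x. x \<in> S \<Longrightarrow> u x = v x"
  shows "Ck_on k S u \<longleftrightarrow> Ck_on k S v"
  using assms(2)
proof (induction k arbitrary: u v)
  case 0
  then show ?case by (simp cong: continuous_on_cong)
next
  case (Suc k)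
  have iff: "(u has_derivative D) (at x) \<longleftrightarrow> (v has_derivative D) (at x)" if "x \<in> S" for x D
    using has_derivative_transform_within_open[OF _ assms(1) that, of u D UNIV v]
      has_derivative_transform_within_open[OF _ assms(1) that, of v D UNIV u] Suc.prems by auto
  then have "frechet_derivative u (at x) = frechet_derivative v (at x)" if "x \<in> S" for x
    using that by (simp add: frechet_derivative_def)
  then have "Ck_on k S (\<lambda>x. frechet_derivative u (at x) d) \<longleftrightarrow>
      Ck_on k S (\<lambda>x. frechet_derivative v (at x) d)" for d
    by (intro Suc.IH) simp
  moreover have "(\<forall>x\<in>S. u differentiable (at x)) \<longleftrightarrow> (\<forall>x\<in>S. v differentiable (at x))"
    using iff by (simp add: differentiable_def)
  ultimately show ?case by simp
qed

lemma smooth_on_cong: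
  assumes "open S" and "\<And>x. x \<in> S \<Longrightarrow> u x = v x"
  shows "smooth_on S u \<longleftrightarrow> smooth_on S v"
  using Ck_on_cong[OF assms] by (simp add: smooth_on_def)

text \<open>A class is usually raised by exhibiting a derivative; the definition asks for
  \<open>frechet_derivative\<close>, a choice that only agrees with the exhibited one on \<open>S\<close>, so openness of
  \<open>S\<close> is used through \<open>Ck_on_cong\<close>.\<close>

lemma Ck_on_SucI:
  assumes "open S"
    and "\<And>x. x \<in> S \<Longrightarrow> (u has_derivative D x) (at x)"
    and "\<And>d. Ck_on k S (\<lambda>x. D x d)"
  shows "Ck_on (Suc k) S u"
proof -
  have "Ck_on k S (\<lambda>x. frechet_derivative u (at x) d) \<longleftrightarrow> Ck_on k S (\<lambda>x. D x d)" for d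
    using assms(2) by (intro Ck_on_cong[OF assms(1)]) (metis frechet_derivative_at)
  then show ?thesis using assms(2,3) by (auto simp: differentiable_def)
qed

lemma Ck_on_SucD:
  assumes "Ck_on (Suc k) S u"
  shows Ck_on_SucD_derivative: "x \<in> S \<Longrightarrow> (u has_derivative frechet_derivative u (at x)) (at x)"
    and Ck_on_SucD_frechet: "Ck_on k S (\<lambda>x. frechet_derivative u (at x) d)"
  using assms by (auto simp: frechet_derivative_works[symmetric])

lemma Ck_on_Suc_imp_Ck_on:
  "Ck_on (Suc k) S u \<Longrightarrow> Ck_on k S u"
proof (induction k arbitrary: u)
  case 0
  then show ?case
    by (auto intro!: continuous_at_imp_continuous_on differentiable_imp_continuous_within)
next
  case (Suc k)
  from Suc.prems show ?case
    using Suc.IH[of "\<lambda>x. frechet_derivative u (at x) _"] by simp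
qed

lemma Ck_on_const: "Ck_on k S (\<lambda>x. c)"
  by (induction k arbitrary: c) auto

lemma smooth_on_const: "smooth_on S (\<lambda>x. c)"
  by (simp add: smooth_on_def Ck_on_const)

lemma smooth_on_bounded_linear:
  assumes "bounded_linear L" and "open S"
  shows "smooth_on S L"
proof -
  have "Ck_on k S L" for k
  proof (cases k)
    case 0
    then show ?thesis using bounded_linear.linear[OF assms(1)] assms(1)
      by (simp add: linear_continuous_on)
  next
    case (Suc k)
    then show ?thesis
      using Ck_on_SucI[OF assms(2), of L "\<lambda>_. L"] assms(1)
      by (simp add: Ck_on_const bounded_linear_imp_has_derivative)
  qed
  then show ?thesis by (simp add: smooth_on_def)
qed

lemma Ck_on_add:
  assumes "open S"
  shows "Ck_on k S u \<Longrightarrow> Ck_on k S v \<Longrightarrow> Ck_on k S (\<lambda>x. u x + v x)"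
proof (induction k arbitrary: u v)
  case 0
  then show ?case by (simp add: continuous_on_add)
next
  case (Suc k)
  show ?case
    by (rule Ck_on_SucI[OF assms])
      (auto intro!: has_derivative_add Ck_on_SucD_derivative[OF Suc.prems(1)] Suc.IH
        Ck_on_SucD_derivative[OF Suc.prems(2)] Ck_on_SucD_frechet[OF Suc.prems(1)]
        Ck_on_SucD_frechet[OF Suc.prems(2)])
qed

lemma Ck_on_mult:
  fixes u v :: "'a::real_normed_vector \<Rightarrow> real"
  assumes "open S"
  shows "Ck_on k S u \<Longrightarrow> Ck_on k S v \<Longrightarrow> Ck_on k S (\<lambda>x. u x * v x)"
proof (induction k arbitrary: u v)
  case 0
  then show ?case by (simp add: continuous_on_mult)
next
  case (Suc k)
  show ?case
    by (rule Ck_on_SucI[OF assms])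
      (auto intro!: has_derivative_mult Ck_on_SucD_derivative[OF Suc.prems(1)] Ck_on_add[OF assms] Suc.IH
        Ck_on_SucD_derivative[OF Suc.prems(2)] Ck_on_SucD_frechet[OF Suc.prems(1)]
        Ck_on_SucD_frechet[OF Suc.prems(2)] intro: Ck_on_Suc_imp_Ck_on Suc.prems simp del: Ck_on.simps)
qed

lemma Ck_on_inverse:
  fixes u :: "'a::real_normed_vector \<Rightarrow> real"
  assumes "open S" and nz: "\<And>x. x \<in> S \<Longrightarrow> u x \<noteq> 0"
  shows "Ck_on k S u \<Longrightarrow> Ck_on k S (\<lambda>x. inverse (u x))"
proof (induction k)
  case 0
  then show ?case using nz by (simp add: continuous_on_inverse)
next
  case (Suc k)
  note iu = Suc.IH[OF Ck_on_Suc_imp_Ck_on[OF Suc.prems]]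
  have neg: "Ck_on k S (\<lambda>x. - 1 * v x)" if "Ck_on k S v" for v :: "'a \<Rightarrow> real"
    using Ck_on_mult[OF assms(1) Ck_on_const[of k S "- 1"] that] .
  show ?case
  proof (rule Ck_on_SucI[OF assms(1)])
    show "((\<lambda>x. inverse (u x)) has_derivative
        (\<lambda>d. - (inverse (u x) * frechet_derivative u (at x) d * inverse (u x)))) (at x)" if "x \<in> S" for x
      using Deriv.has_derivative_inverse[OF nz[OF that] Ck_on_SucD_derivative[OF Suc.prems that]] .
    show "Ck_on k S (\<lambda>x. - (inverse (u x) * frechet_derivative u (at x) d * inverse (u x)))" for d
      using neg[OF Ck_on_mult[OF assms(1) Ck_on_mult[OF assms(1) iu Ck_on_SucD_frechet[OF Suc.prems]] iu]]
      by simp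
  qed
qed

lemma smooth_on_add: "open S \<Longrightarrow> smooth_on S u \<Longrightarrow> smooth_on S v \<Longrightarrow> smooth_on S (\<lambda>x. u x + v x)"
  by (simp add: smooth_on_def Ck_on_add)

lemma smooth_on_mult:
  fixes u v :: "'a::real_normed_vector \<Rightarrow> real"
  shows "open S \<Longrightarrow> smooth_on S u \<Longrightarrow> smooth_on S v \<Longrightarrow> smooth_on S (\<lambda>x. u x * v x)"
  by (simp add: smooth_on_def Ck_on_mult)

lemma smooth_on_inverse:
  fixes u :: "'a::real_normed_vector \<Rightarrow> real"
  shows "open S \<Longrightarrow> (\<And>x. x \<in> S \<Longrightarrow> u x \<noteq> 0) \<Longrightarrow> smooth_on S u \<Longrightarrow> smooth_on S (\<lambda>x. inverse (u x))"
  by (simp add: smooth_on_def Ck_on_inverse)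

lemma smooth_on_linear_compose:
  assumes L: "bounded_linear L" and S: "open S" and u: "smooth_on S u"
  shows "smooth_on S (\<lambda>x. L (u x))"
proof -
  have "Ck_on k S v \<Longrightarrow> Ck_on k S (\<lambda>x. L (v x))" for k v
  proof (induction k arbitrary: v)
    case 0
    then show ?case using bounded_linear.continuous_on[OF L] by simp
  next
    case (Suc k)
    show ?case
      by (rule Ck_on_SucI[OF S])
        (auto intro!: bounded_linear.has_derivative[OF L] Ck_on_SucD_derivative[OF Suc.prems] Suc.IH
          Ck_on_SucD_frechet[OF Suc.prems])
  qed
  then show ?thesis using u by (simp add: smooth_on_def)
qed

lemma smooth_on_compose_linear:
  fixes u :: "'b::real_normed_vector \<Rightarrow> 'c::real_normed_vector"
  assumes L: "bounded_linear L" and S: "open S" and u: "smooth_on S u" and T: "open T" "L ` T \<subseteq> S"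
  shows "smooth_on T (\<lambda>x. u (L x))"
proof -
  have "Ck_on k S v \<Longrightarrow> Ck_on k T (\<lambda>x. v (L x))" for k and v :: "'b \<Rightarrow> 'c"
  proof (induction k arbitrary: v)
    case 0
    then show ?case
      using continuous_on_compose2[of S v T L] linear_continuous_on[OF L] T(2) by simp
  next
    case (Suc k)
    show ?case
    proof (rule Ck_on_SucI[OF T(1)])
      show "((\<lambda>x. v (L x)) has_derivative (\<lambda>d. frechet_derivative v (at (L x)) (L d))) (at x)"
        if "x \<in> T" for x
        using has_derivative_compose[OF bounded_linear_imp_has_derivative[OF L]
            Ck_on_SucD_derivative[OF Suc.prems, of "L x"]] T(2) that by blast
      show "Ck_on k T (\<lambda>x. frechet_derivative v (at (L x)) (L d))" for d
        using Suc.IH[OF Ck_on_SucD_frechet[OF Suc.prems, of "L d"]] .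
    qed
  qed
  then show ?thesis using u by (simp add: smooth_on_def)
qed

lemma smooth_on_frechet_derivative:
  "smooth_on S u \<Longrightarrow> smooth_on S (\<lambda>x. frechet_derivative u (at x) d)"
  using Ck_on_SucD_frechet unfolding smooth_on_def by blast

lemma smooth_on_has_derivative:
  "smooth_on S u \<Longrightarrow> x \<in> S \<Longrightarrow> (u has_derivative frechet_derivative u (at x)) (at x)"
  using Ck_on_SucD_derivative unfolding smooth_on_def by blast

text \<open>The derivative in the sense of real analysis is the value of the Frechet derivative at \<open>1\<close>, so
  smoothness of \<open>u\<close> passes to \<open>deriv u\<close> directly.\<close>

lemma smooth_on_deriv:
  fixes u :: "real \<Rightarrow> real"
  assumes "smooth_on UNIV u"
  shows has_real_derivative_smooth: "(u has_real_derivative deriv u t) (at t)"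
    and smooth_deriv: "smooth_on UNIV (deriv u)"
proof -
  have D: "(u has_real_derivative frechet_derivative u (at t) 1) (at t)" for t
  proof -
    note d = smooth_on_has_derivative[OF assms UNIV_I[of t]]
    have "frechet_derivative u (at t) = (*) (frechet_derivative u (at t) 1)"
    proof
      fix s
      show "frechet_derivative u (at t) s = frechet_derivative u (at t) 1 * s"
        using linear_cmul[OF has_derivative_linear[OF d], of s 1] by simp
    qed
    with d show ?thesis by (simp add: has_field_derivative_def)
  qed
  then have e: "deriv u = (\<lambda>t. frechet_derivative u (at t) 1)"
    by (auto intro: DERIV_imp_deriv)
  show "(u has_real_derivative deriv u t) (at t)" using D e by simp
  show "smooth_on UNIV (deriv u)" unfolding e by (rule smooth_on_frechet_derivative[OF assms])
qed

section \<open>Block matrices and coordinates on a product\<close>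

lemma sum_UNIV_Plus:
  fixes F :: "'a::finite + 'b::finite \<Rightarrow> 'c::comm_monoid_add"
  shows "(\<Sum>k\<in>UNIV. F k) = (\<Sum>i\<in>UNIV. F (Inl i)) + (\<Sum>j\<in>UNIV. F (Inr j))"
  using sum.Plus[of "UNIV :: 'a set" "UNIV :: 'b set" F] by (simp add: o_def)

lemma vec_left_nth [simp]: "vec_left z $ i = z $ Inl i"
  and vec_right_nth [simp]: "vec_right z $ j = z $ Inr j"
  and vec_join_Inl [simp]: "vec_join x y $ Inl i = x $ i"
  and vec_join_Inr [simp]: "vec_join x y $ Inr j = y $ j"
  by (simp_all add: vec_left_def vec_right_def vec_join_def)

lemma vec_sum_eq_iff:
  "(z :: 'a^('b::finite + 'm::finite)) = z' \<longleftrightarrow> (\<forall>i. z $ Inl i = z' $ Inl i) \<and> (\<forall>j. z $ Inr j = z' $ Inr j)"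
  unfolding vec_eq_iff by (auto, metis sum.exhaust)

lemma vec_left_join [simp]: "vec_left (vec_join x y) = x"
  and vec_right_join [simp]: "vec_right (vec_join x y) = y"
  and vec_join_left_right [simp]: "vec_join (vec_left z) (vec_right z) = z"
  by (simp add: vec_eq_iff, simp add: vec_eq_iff, simp add: vec_sum_eq_iff)

lemma vec_left_axis [simp]:
  "vec_left (axis (Inl i) 1) = axis i 1" "vec_left (axis (Inr j) 1) = 0"
  and vec_right_axis [simp]:
  "vec_right (axis (Inl i) 1) = 0" "vec_right (axis (Inr j) 1) = axis j 1"
  by (simp_all add: vec_eq_iff axis_def)

lemma bounded_linear_vec_left: "bounded_linear (vec_left :: real^('b::finite + 'm::finite) \<Rightarrow> real^'b)"
  and bounded_linear_vec_right: "bounded_linear (vec_right :: real^('b::finite + 'm::finite) \<Rightarrow> real^'m)"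
  by (auto simp: linear_conv_bounded_linear[symmetric] vec_eq_iff intro!: linearI)

lemma block_diag_nth [simp]:
  "block_diag A D $ Inl i $ Inl j = A $ i $ j" "block_diag A D $ Inr a $ Inr b = D $ a $ b"
  "block_diag A D $ Inl i $ Inr b = 0" "block_diag A D $ Inr a $ Inl j = 0"
  by (simp_all add: block_diag_def)

lemma block_diag_mult: "block_diag A D ** block_diag A' D' = block_diag (A ** A') (D ** D')"
  by (simp add: vec_sum_eq_iff matrix_matrix_mult_def sum_UNIV_Plus)

lemma block_diag_mat: "block_diag (mat c) (mat c) = mat c"
  by (simp add: vec_sum_eq_iff mat_def)

lemma transpose_block_diag: "transpose (block_diag A D) = block_diag (transpose A) (transpose D)"
  by (simp add: vec_sum_eq_iff transpose_def)

lemma scaleR_matrix_mult: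
  fixes A :: "real^'k::finite^'m::finite" and B :: "real^'n::finite^'k"
  shows "(a *\<^sub>R A) ** (b *\<^sub>R B) = (a * b) *\<^sub>R (A ** B)"
  by (simp add: vec_eq_iff matrix_matrix_mult_def sum_distrib_left algebra_simps)

lemma invertible_block_diag:
  assumes "invertible A" "invertible D"
  shows "invertible (block_diag A D)"
proof -
  from assms obtain A' D' where "A ** A' = mat 1" "A' ** A = mat 1" "D ** D' = mat 1" "D' ** D = mat 1"
    unfolding invertible_def by blast
  then have "block_diag A D ** block_diag A' D' = mat 1 \<and> block_diag A' D' ** block_diag A D = mat 1"
    by (simp add: block_diag_mult block_diag_mat)
  then show ?thesis unfolding invertible_def by blast
qed

lemma scaleR_congruence:
  fixes X :: "real^'k^'k::finite"
  shows "transpose J ** (c *\<^sub>R X) ** J = c *\<^sub>R (transpose J ** X ** J)"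
  using scaleR_matrix_mult[of 1 "transpose J" c X] scaleR_matrix_mult[of c "transpose J ** X" 1 J] by simp

lemma invertible_scaleR:
  fixes A :: "real^'k^'k::finite"
  assumes "invertible A" "c \<noteq> 0"
  shows "invertible (c *\<^sub>R A)"
proof -
  obtain A' where "A ** A' = mat 1" "A' ** A = mat 1" using assms(1) invertible_def by blast
  then have "(c *\<^sub>R A) ** ((1 / c) *\<^sub>R A') = mat 1 \<and> ((1 / c) *\<^sub>R A') ** (c *\<^sub>R A) = mat 1"
    using assms(2) by (simp add: scaleR_matrix_mult)
  then show ?thesis unfolding invertible_def by blast
qed

lemma diag_matrix_mult: "diag_matrix d ** diag_matrix e = diag_matrix (\<chi> i. d $ i * e $ i)"
proof -
  have "(\<Sum>k\<in>UNIV. (if i = k then d $ i else 0) * (if k = j then e $ k else 0))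
      = (if i = j then d $ i * e $ i else 0)" for i j
    by (simp add: if_distrib[of "\<lambda>x. x * _"] cong: if_cong)
  then show ?thesis by (simp add: vec_eq_iff diag_matrix_def matrix_matrix_mult_def)
qed

lemma mat_eq_diag_matrix: "mat 1 = diag_matrix (\<chi> i. 1)"
  by (simp add: vec_eq_iff diag_matrix_def mat_def)

lemma matrix_inv_left_right:
  fixes A :: "real^'i^'i::finite"
  assumes "invertible A"
  shows "A ** matrix_inv A = mat 1" "matrix_inv A ** A = mat 1"
  using someI_ex[OF assms[unfolded invertible_def]] unfolding matrix_inv_def by auto

lemma matrix_inv_eqI:
  fixes A :: "real^'i^'i::finite"
  assumes "A ** B = mat 1" "B ** A = mat 1"
  shows "matrix_inv A = B"
proof -
  have "invertible A" using assms invertible_def by blast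
  then have "B ** (A ** matrix_inv A) = B" by (simp add: matrix_inv_left_right)
  then show ?thesis by (simp add: matrix_mul_assoc assms)
qed

text \<open>Cramer's rule, applied to the columns of the identity. It expresses the entries of the inverse as
  quotients of polynomials in the entries of \<open>A\<close>, which makes them differentiable along with \<open>A\<close>.\<close>

lemma matrix_inv_nth_cramer:
  fixes A :: "real^'i^'i::finite"
  assumes "invertible A"
  shows "matrix_inv A $ k $ l = det (\<chi> i j. if j = k then axis l 1 $ i else A $ i $ j) / det A"
proof -
  have "A *v (matrix_inv A *v axis l 1) = axis l 1"
    by (simp add: matrix_vector_mul_assoc matrix_inv_left_right[OF assms])
  then have "matrix_inv A *v axis l 1 = (\<chi> k. det (\<chi> i j. if j = k then axis l 1 $ i else A $ i $ j) / det A)"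
    using cramer assms invertible_det_nz by blast
  then show ?thesis by (simp add: matrix_vector_mult_basis column_def vec_eq_iff)
qed

lemma differentiable_det:
  fixes N :: "'a::real_normed_vector \<Rightarrow> real^'i^'i::finite"
  assumes "\<And>i j. (\<lambda>y. N y $ i $ j) differentiable (at y)"
  shows "(\<lambda>y. det (N y)) differentiable (at y)"
proof -
  have "(\<lambda>y. \<Prod>i\<in>UNIV. N y $ i $ p i) differentiable (at y)" for p
  proof -
    have "\<forall>i. \<exists>D. ((\<lambda>y. N y $ i $ p i) has_derivative D) (at y)"
      using assms by (simp add: differentiable_def)
    then obtain D where D: "\<And>i. ((\<lambda>y. N y $ i $ p i) has_derivative D i) (at y)"
      by metis
    have "((\<lambda>y. \<Prod>i\<in>UNIV. N y $ i $ p i) has_derivative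
        (\<lambda>d. \<Sum>i\<in>UNIV. D i d * (\<Prod>j\<in>UNIV - {i}. N y $ j $ p j))) (at y)"
      by (rule has_derivative_prod) (rule D)
    then show ?thesis unfolding differentiable_def by blast
  qed
  then show ?thesis unfolding det_def by (intro differentiable_sum) auto
qed

lemma differentiable_matrix_inv:
  fixes N :: "'a::real_normed_vector \<Rightarrow> real^'i^'i::finite"
  assumes "open U" "y \<in> U" and inv: "\<And>z. z \<in> U \<Longrightarrow> invertible (N z)"
    and diff: "\<And>i j. (\<lambda>z. N z $ i $ j) differentiable (at y)"
  shows "(\<lambda>z. matrix_inv (N z) $ k $ l) differentiable (at y)"
proof -
  have entry: "(\<lambda>z. if j = k then axis l 1 $ i else N z $ i $ j) differentiable (at y)" for i j
    using diff by (cases "j = k") auto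
  have "(\<lambda>z. det (\<chi> i j. if j = k then axis l 1 $ i else N z $ i $ j) / det (N z)) differentiable (at y)"
    using inv[OF assms(2)] diff
    by (intro differentiable_divide differentiable_det) (simp_all add: invertible_det_nz entry)
  then obtain D where "((\<lambda>z. det (\<chi> i j. if j = k then axis l 1 $ i else N z $ i $ j) / det (N z))
      has_derivative D) (at y)"
    unfolding differentiable_def by blast
  then have "((\<lambda>z. matrix_inv (N z) $ k $ l) has_derivative D) (at y)"
    by (rule has_derivative_transform_within_open[OF _ assms(1,2)])
      (simp add: matrix_inv_nth_cramer[OF inv])
  then show ?thesis unfolding differentiable_def by blast
qed

section \<open>Partial derivatives on a product\<close>

lemma partial_eqI: "(u has_derivative D) (at y) \<Longrightarrow> partial i u y = D (axis i 1)"
  by (metis frechet_derivative_at partial_def)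

lemma partial_cong:
  assumes "open S" "y \<in> S" and "\<And>x. x \<in> S \<Longrightarrow> u x = v x"
  shows "partial i u y = partial i v y"
proof -
  have "(u has_derivative D) (at y) \<longleftrightarrow> (v has_derivative D) (at y)" for D
    using has_derivative_transform_within_open[OF _ assms(1,2), of u D UNIV v]
      has_derivative_transform_within_open[OF _ assms(1,2), of v D UNIV u] assms(3) by auto
  then show ?thesis by (simp add: partial_def frechet_derivative_def)
qed

text \<open>Every component of the metric and of its Christoffel symbols is a function of \<open>\<alpha> \<bullet> x\<close> times a
  function on the fibre, so this product rule is the only differentiation rule for them.
  Differentiability of \<open>b\<close> is essential, since \<open>partial\<close> is an arbitrary value at
  points where the function is not differentiable.\<close>

lemma partial_prod:
  fixes \<alpha> :: "real^'n::finite" and b :: "real^'m::finite \<Rightarrow> real" and z :: "real^('n + 'm)"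
  assumes "(w has_real_derivative w') (at (\<alpha> \<bullet> vec_left z))" and "b differentiable (at (vec_right z))"
  shows partial_prod_Inl: "partial (Inl i) (\<lambda>z. w (\<alpha> \<bullet> vec_left z) * b (vec_right z)) z = w' * \<alpha> $ i * b (vec_right z)"
    and partial_prod_Inr: "partial (Inr c) (\<lambda>z. w (\<alpha> \<bullet> vec_left z) * b (vec_right z)) z
      = w (\<alpha> \<bullet> vec_left z) * partial c b (vec_right z)"
proof -
  let ?D = "\<lambda>d. w (\<alpha> \<bullet> vec_left z) * frechet_derivative b (at (vec_right z)) (vec_right d)
    + w' * (\<alpha> \<bullet> vec_left d) * b (vec_right z)"
  have "((\<lambda>z. w (\<alpha> \<bullet> vec_left z)) has_derivative (\<lambda>d. w' * (\<alpha> \<bullet> vec_left d))) (at z)"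
    using has_derivative_compose[OF bounded_linear_imp_has_derivative
        [OF bounded_linear_compose[OF bounded_linear_inner_right bounded_linear_vec_left]]
        assms(1)[unfolded has_field_derivative_def]] by simp
  moreover have "((\<lambda>z. b (vec_right z)) has_derivative (\<lambda>d. frechet_derivative b (at (vec_right z)) (vec_right d))) (at z)"
    using has_derivative_compose[OF bounded_linear_imp_has_derivative[OF bounded_linear_vec_right]]
      assms(2) frechet_derivative_works by blast
  ultimately have "((\<lambda>z. w (\<alpha> \<bullet> vec_left z) * b (vec_right z)) has_derivative ?D) (at z)"
    by (rule has_derivative_mult)
  note * = partial_eqI[OF this]
  have 0: "frechet_derivative b (at (vec_right z)) 0 = 0"
    by (rule linear_0[OF linear_frechet_derivative[OF assms(2)]])
  show "partial (Inl i) (\<lambda>z. w (\<alpha> \<bullet> vec_left z) * b (vec_right z)) z = w' * \<alpha> $ i * b (vec_right z)"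
    using 0 by (simp add: * inner_axis)
  show "partial (Inr c) (\<lambda>z. w (\<alpha> \<bullet> vec_left z) * b (vec_right z)) z
      = w (\<alpha> \<bullet> vec_left z) * partial c b (vec_right z)"
    by (simp add: *) (simp add: partial_def)
qed

lemma partial_ridge:
  fixes \<alpha> :: "real^'n::finite" and z :: "real^('n + 'm::finite)"
  assumes "(w has_real_derivative w') (at (\<alpha> \<bullet> vec_left z))"
  shows partial_ridge_Inl: "partial (Inl i) (\<lambda>z::real^('n + 'm). w (\<alpha> \<bullet> vec_left z) * c) z = w' * \<alpha> $ i * c"
    and partial_ridge_Inr: "partial (Inr a) (\<lambda>z::real^('n + 'm). w (\<alpha> \<bullet> vec_left z) * c) z = 0"
  using partial_prod[OF assms, of "\<lambda>_. c"] by (simp_all add: partial_def)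

lemma partial_const [simp]: "partial i (\<lambda>_. c) z = 0"
  by (simp add: partial_def)

lemma hessian_cong:
  assumes S: "open S" "y \<in> S" and eq: "\<And>x. x \<in> S \<Longrightarrow> u x = v x"
  shows "hessian G u i j y = hessian G v i j y"
proof -
  have p: "partial k u x = partial k v x" if "x \<in> S" for k x
    by (rule partial_cong[OF S(1) that eq])
  have "partial i (partial j u) y = partial i (partial j v) y"
    by (rule partial_cong[OF S p])
  then show ?thesis unfolding hessian_def by (simp only: p[OF S(2)])
qed

section \<open>Curvature and Hessian of a metric warped along a null direction\<close>

text \<open>The setting of one product chart: base coordinates \<open>x\<close> in all of \<open>real^'n\<close>, fibre coordinates in \<open>U\<close>,
  and the metric \<open>u(\<alpha> \<bullet> x) \<epsilon> \<oplus> w(\<alpha> \<bullet> x) \<gamma>\<close>. The assumption \<open>eps\<close> encodes \<open>\<epsilon>\<^sub>i = \<plusminus>1\<close>.\<close>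

locale null_warped =
  fixes \<epsilon> \<alpha> :: "real^'n::finite" and u w :: "real \<Rightarrow> real"
    and \<gamma> :: "real^'m::finite \<Rightarrow> real^'m^'m" and U :: "(real^'m) set"
  assumes eps: "\<epsilon> $ i * \<epsilon> $ i = 1"
    and null: "(\<Sum>k\<in>UNIV. \<epsilon> $ k * (\<alpha> $ k)\<^sup>2) = 0"
    and u: "smooth_on UNIV u" "u t \<noteq> 0"
    and w: "smooth_on UNIV w" "w t \<noteq> 0"
    and U: "open U"
    and smooth: "smooth_on U (\<lambda>y. \<gamma> y $ a $ b)"
    and sym: "y \<in> U \<Longrightarrow> \<gamma> y $ a $ b = \<gamma> y $ b $ a"
    and inv: "y \<in> U \<Longrightarrow> invertible (\<gamma> y)"
begin

abbreviation s :: "real^('n + 'm) \<Rightarrow> real" where "s z \<equiv> \<alpha> \<bullet> vec_left z"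

definition G :: "real^('n + 'm) \<Rightarrow> real^('n + 'm)^('n + 'm)" where
  "G z = block_diag (u (s z) *\<^sub>R diag_matrix \<epsilon>) (w (s z) *\<^sub>R \<gamma> (vec_right z))"

definition V :: "(real^('n + 'm)) set" where "V = {z. vec_right z \<in> U}"

text \<open>In the Christoffel symbols the derivatives of \<open>u\<close> and \<open>w\<close> enter only through the following three
  quotients. \<open>A\<close> and \<open>B\<close> are half the logarithmic derivatives of \<open>u\<close> and \<open>w\<close>; \<open>C\<close> comes from
  raising a base index on the derivative of \<open>w\<close>.\<close>

definition A :: "real \<Rightarrow> real" where "A t = deriv u t / (2 * u t)"
definition B :: "real \<Rightarrow> real" where "B t = deriv w t / (2 * w t)"
definition C :: "real \<Rightarrow> real" where "C t = deriv w t / (2 * u t)"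

text \<open>For the conformally flat metric \<open>u(\<alpha> \<bullet> x) \<epsilon>\<close> the Christoffel symbol is \<open>A\<close> times this constant
  coefficient: the difference tensor of two conformal metrics, with \<open>\<alpha>\<close> as the gradient covector.\<close>

definition T :: "'n \<Rightarrow> 'n \<Rightarrow> 'n \<Rightarrow> real" where
  "T k i j = \<alpha> $ i * (if j = k then 1 else 0) + \<alpha> $ j * (if i = k then 1 else 0)
     - \<epsilon> $ k * \<alpha> $ k * (if i = j then \<epsilon> $ i else 0)"

lemma open_V: "open V"
proof -
  have "V = vec_right -` U" by (auto simp: V_def)
  then show ?thesis
    using U by (auto intro: open_vimage linear_continuous_on bounded_linear_vec_right)
qed

lemma du: "(u has_real_derivative deriv u t) (at t)"
  and dw: "(w has_real_derivative deriv w t) (at t)"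
  using has_real_derivative_smooth u(1) w(1) by auto

lemma dA: "(A has_real_derivative deriv A t) (at t)"
  and dB: "(B has_real_derivative deriv B t) (at t)"
  and dC: "(C has_real_derivative deriv C t) (at t)"
proof -
  have q: "smooth_on UNIV (\<lambda>t. deriv v t / (2 * x t))"
    if "smooth_on UNIV v" "smooth_on UNIV x" "\<And>t. x t \<noteq> 0" for v x :: "real \<Rightarrow> real"
  proof -
    have "smooth_on UNIV (\<lambda>t. deriv v t * inverse (2 * x t))"
      using that
      by (intro smooth_on_mult smooth_on_inverse smooth_deriv smooth_on_const) auto
    then show ?thesis by (simp only: divide_inverse)
  qed
  show "(A has_real_derivative deriv A t) (at t)"
    using has_real_derivative_smooth[OF q[OF u(1) u(1) u(2)]] unfolding A_def[abs_def] .
  show "(B has_real_derivative deriv B t) (at t)"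
    using has_real_derivative_smooth[OF q[OF w(1) w(1) w(2)]] unfolding B_def[abs_def] .
  show "(C has_real_derivative deriv C t) (at t)"
    using has_real_derivative_smooth[OF q[OF w(1) u(1) u(2)]] unfolding C_def[abs_def] .
qed

lemma G_nth:
  "G z $ Inl i $ Inl j = u (s z) * (if i = j then \<epsilon> $ i else 0)"
  "G z $ Inr a $ Inr b = w (s z) * \<gamma> (vec_right z) $ a $ b"
  "G z $ Inl i $ Inr b = 0" "G z $ Inr a $ Inl j = 0"
  by (simp_all add: G_def diag_matrix_def)

lemma diff_\<gamma>: "y \<in> U \<Longrightarrow> (\<lambda>y. \<gamma> y $ a $ b) differentiable (at y)"
  using smooth_on_has_derivative[OF smooth] differentiable_def by blast

lemma matrix_inv_G:
  assumes "z \<in> V"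
  shows "matrix_inv (G z) = block_diag ((1 / u (s z)) *\<^sub>R diag_matrix \<epsilon>) ((1 / w (s z)) *\<^sub>R matrix_inv (\<gamma> (vec_right z)))"
proof -
  have i: "invertible (\<gamma> (vec_right z))" using assms inv by (simp add: V_def)
  have e: "diag_matrix \<epsilon> ** diag_matrix \<epsilon> = mat 1"
    by (simp add: diag_matrix_mult mat_eq_diag_matrix eps)
  show ?thesis
    unfolding G_def
    by (rule matrix_inv_eqI)
      (simp_all add: block_diag_mult u(2) w(2) e matrix_inv_left_right[OF i] block_diag_mat scaleR_matrix_mult)
qed

lemma matrix_inv_G_nth:
  assumes "z \<in> V"
  shows "matrix_inv (G z) $ Inl i $ Inl j = (if i = j then \<epsilon> $ i / u (s z) else 0)"
  "matrix_inv (G z) $ Inr a $ Inr b = matrix_inv (\<gamma> (vec_right z)) $ a $ b / w (s z)"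
  "matrix_inv (G z) $ Inl i $ Inr b = 0" "matrix_inv (G z) $ Inr a $ Inl j = 0"
  by (simp_all add: matrix_inv_G[OF assms] diag_matrix_def)

lemma partial_G:
  assumes "z \<in> V"
  shows "partial (Inl k) (\<lambda>z. G z $ Inl i $ Inl j) z = deriv u (s z) * \<alpha> $ k * (if i = j then \<epsilon> $ i else 0)"
    "partial (Inr c) (\<lambda>z. G z $ Inl i $ Inl j) z = 0"
    "partial (Inl k) (\<lambda>z. G z $ Inr a $ Inr b) z = deriv w (s z) * \<alpha> $ k * \<gamma> (vec_right z) $ a $ b"
    "partial (Inr c) (\<lambda>z. G z $ Inr a $ Inr b) z = w (s z) * partial c (\<lambda>y. \<gamma> y $ a $ b) (vec_right z)"
    "partial k' (\<lambda>z. G z $ Inl i $ Inr b) z = 0"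
    "partial k' (\<lambda>z. G z $ Inr a $ Inl j) z = 0"
proof -
  have d: "(\<lambda>y. \<gamma> y $ a $ b) differentiable at (vec_right z)"
    using assms diff_\<gamma> by (simp add: V_def)
  show "partial (Inl k) (\<lambda>z. G z $ Inl i $ Inl j) z = deriv u (s z) * \<alpha> $ k * (if i = j then \<epsilon> $ i else 0)"
    "partial (Inr c) (\<lambda>z. G z $ Inl i $ Inl j) z = 0"
    unfolding G_nth by (rule partial_ridge_Inl[OF du], rule partial_ridge_Inr[OF du])
  show "partial (Inl k) (\<lambda>z. G z $ Inr a $ Inr b) z = deriv w (s z) * \<alpha> $ k * \<gamma> (vec_right z) $ a $ b"
    "partial (Inr c) (\<lambda>z. G z $ Inr a $ Inr b) z = w (s z) * partial c (\<lambda>y. \<gamma> y $ a $ b) (vec_right z)"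
    unfolding G_nth by (rule partial_prod_Inl[OF dw d], rule partial_prod_Inr[OF dw d])
qed (simp_all add: G_nth)

text \<open>The contraction that appears in the mixed symbols \<open>\<Gamma>\<^sup>c\<^sub>i\<^sub>b\<close>; reading it as
  a matrix product uses the symmetry of \<open>\<gamma>\<close>.\<close>

lemma inv_mult_\<gamma>:
  assumes "y \<in> U"
  shows "(\<Sum>l\<in>UNIV. matrix_inv (\<gamma> y) $ c $ l * \<gamma> y $ a $ l) = (if c = a then 1 else 0)"
proof -
  have "(\<Sum>l\<in>UNIV. matrix_inv (\<gamma> y) $ c $ l * \<gamma> y $ a $ l) = (matrix_inv (\<gamma> y) ** \<gamma> y) $ c $ a"
    by (simp add: matrix_matrix_mult_def sym[OF assms, of a])
  then show ?thesis by (simp add: matrix_inv_left_right[OF inv[OF assms]] mat_def)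
qed

lemma christoffel_G:
  assumes z: "z \<in> V"
  shows "christoffel G (Inl k) (Inl i) (Inl j) z = A (s z) * T k i j"
    "christoffel G (Inl k) (Inl i) (Inr b) z = 0"
    "christoffel G (Inl k) (Inr a) (Inl j) z = 0"
    "christoffel G (Inl k) (Inr a) (Inr b) z = C (s z) * (- \<epsilon> $ k * \<alpha> $ k) * \<gamma> (vec_right z) $ a $ b"
    "christoffel G (Inr c) (Inl i) (Inl j) z = 0"
    "christoffel G (Inr c) (Inl i) (Inr b) z = B (s z) * (\<alpha> $ i * (if c = b then 1 else 0))"
    "christoffel G (Inr c) (Inr a) (Inl j) z = B (s z) * (\<alpha> $ j * (if c = a then 1 else 0))"
    "christoffel G (Inr c) (Inr a) (Inr b) z = christoffel \<gamma> c a b (vec_right z)"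
proof -
  note [simp] = christoffel_def sum_UNIV_Plus matrix_inv_G_nth[OF z] partial_G[OF z]
  have zU: "vec_right z \<in> U" using z by (simp add: V_def)
  have delta: "(\<Sum>l\<in>UNIV. (if k = l then x else 0) * f l) = x * f k" for k :: 'n and x :: real and f
    by (simp add: if_distrib[of "\<lambda>x. x * _"] cong: if_cong)
  have e: "\<epsilon> $ k * (\<epsilon> $ k * x) = x" for k x
    using eps[of k] by (simp flip: mult.assoc)
  show "christoffel G (Inl k) (Inl i) (Inl j) z = A (s z) * T k i j"
    by (simp add: delta A_def T_def, cases "i = j"; cases "i = k"; cases "j = k")
      (simp_all add: field_simps e eps u(2))
  show "christoffel G (Inl k) (Inr a) (Inr b) z = C (s z) * (- \<epsilon> $ k * \<alpha> $ k) * \<gamma> (vec_right z) $ a $ b"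
    by (simp add: delta sum_negf C_def)
  have "(\<Sum>l\<in>UNIV. matrix_inv (\<gamma> (vec_right z)) $ c $ l / w (s z) * (deriv w (s z) * \<alpha> $ i * \<gamma> (vec_right z) $ b $ l))
     = (deriv w (s z) * \<alpha> $ i / w (s z)) * (\<Sum>l\<in>UNIV. matrix_inv (\<gamma> (vec_right z)) $ c $ l * \<gamma> (vec_right z) $ b $ l)" for i b
    by (simp add: sum_distrib_left field_simps)
  then have r: "(\<Sum>l\<in>UNIV. matrix_inv (\<gamma> (vec_right z)) $ c $ l / w (s z) * (deriv w (s z) * \<alpha> $ i * \<gamma> (vec_right z) $ b $ l))
     = (deriv w (s z) * \<alpha> $ i / w (s z)) * (if c = b then 1 else 0)" for i b
    by (simp only: inv_mult_\<gamma>[OF zU])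
  show "christoffel G (Inr c) (Inl i) (Inr b) z = B (s z) * (\<alpha> $ i * (if c = b then 1 else 0))"
    using r[of i b] by (simp add: B_def)
  show "christoffel G (Inr c) (Inr a) (Inl j) z = B (s z) * (\<alpha> $ j * (if c = a then 1 else 0))"
    using r[of j a] by (simp add: B_def)
  have "w (s z) * p + w (s z) * q - w (s z) * r = w (s z) * (p + q - r)" for p q r
    by (simp add: algebra_simps)
  then show "christoffel G (Inr c) (Inr a) (Inr b) z = christoffel \<gamma> c a b (vec_right z)"
    by (simp add: w(2))
  show "christoffel G (Inl k) (Inl i) (Inr b) z = 0"
    "christoffel G (Inl k) (Inr a) (Inl j) z = 0"
    "christoffel G (Inr c) (Inl i) (Inl j) z = 0"
    by simp_all
qed

text \<open>Needed to differentiate the fibre symbols as functions on the product.\<close>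

lemma diff_christoffel:
  assumes "y \<in> U"
  shows "christoffel \<gamma> c a b differentiable (at y)"
proof -
  have p: "(\<lambda>y. partial i (\<lambda>z. \<gamma> z $ j $ l) y) differentiable (at y)" for i j l
    using smooth_on_has_derivative[OF smooth_on_frechet_derivative[OF smooth] assms]
    unfolding partial_def differentiable_def by blast
  have "(\<lambda>y. 1/2 * (\<Sum>l\<in>UNIV. matrix_inv (\<gamma> y) $ c $ l *
       (partial a (\<lambda>z. \<gamma> z $ b $ l) y + partial b (\<lambda>z. \<gamma> z $ a $ l) y - partial l (\<lambda>z. \<gamma> z $ a $ b) y)))
     differentiable (at y)"
    using differentiable_matrix_inv[OF U assms inv diff_\<gamma>[OF assms]]
    by (intro differentiable_mult differentiable_sum differentiable_add differentiable_diff p ballI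
        differentiable_const finite) auto
  then show ?thesis by (simp add: christoffel_def[abs_def])
qed

lemma partial_christoffel_G:
  assumes z: "z \<in> V"
  shows "partial (Inl l) (christoffel G (Inl k) (Inl i) (Inl j)) z = deriv A (s z) * \<alpha> $ l * T k i j"
    "partial q (christoffel G (Inl k) (Inl i) (Inr b)) z = 0"
    "partial q (christoffel G (Inl k) (Inr a) (Inl j)) z = 0"
    "partial (Inl l) (christoffel G (Inl k) (Inr a) (Inr b)) z
       = deriv C (s z) * \<alpha> $ l * (- \<epsilon> $ k * \<alpha> $ k * \<gamma> (vec_right z) $ a $ b)"
    "partial q (christoffel G (Inr c) (Inl i) (Inl j)) z = 0"
    "partial (Inl l) (christoffel G (Inr c) (Inl i) (Inr b)) z
       = deriv B (s z) * \<alpha> $ l * (\<alpha> $ i * (if c = b then 1 else 0))"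
    "partial (Inr d) (christoffel G (Inr c) (Inr a) (Inr b)) z = partial d (christoffel \<gamma> c a b) (vec_right z)"
proof -
  have zU: "vec_right z \<in> U" using z by (simp add: V_def)
  note cong = partial_cong[OF open_V z, OF christoffel_G(1)] partial_cong[OF open_V z, OF christoffel_G(2)]
    partial_cong[OF open_V z, OF christoffel_G(3)] partial_cong[OF open_V z, OF christoffel_G(4)]
    partial_cong[OF open_V z, OF christoffel_G(5)] partial_cong[OF open_V z, OF christoffel_G(6)]
    partial_cong[OF open_V z, OF christoffel_G(8)]
  show "partial (Inl l) (christoffel G (Inl k) (Inl i) (Inl j)) z = deriv A (s z) * \<alpha> $ l * T k i j"
    by (simp only: cong partial_ridge_Inl[OF dA])
  show "partial q (christoffel G (Inl k) (Inl i) (Inr b)) z = 0"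
    "partial q (christoffel G (Inl k) (Inr a) (Inl j)) z = 0"
    "partial q (christoffel G (Inr c) (Inl i) (Inl j)) z = 0"
    by (simp_all add: cong)
  have "(\<lambda>y. (- \<epsilon> $ k * \<alpha> $ k) * \<gamma> y $ a $ b) differentiable (at (vec_right z))"
    using diff_\<gamma>[OF zU] by (intro differentiable_mult) auto
  from partial_prod_Inl[OF dC this]
  show "partial (Inl l) (christoffel G (Inl k) (Inr a) (Inr b)) z
       = deriv C (s z) * \<alpha> $ l * (- \<epsilon> $ k * \<alpha> $ k * \<gamma> (vec_right z) $ a $ b)"
    by (simp only: cong mult.assoc)
  show "partial (Inl l) (christoffel G (Inr c) (Inl i) (Inr b)) z
       = deriv B (s z) * \<alpha> $ l * (\<alpha> $ i * (if c = b then 1 else 0))"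
    by (simp only: cong partial_ridge_Inl[OF dB])
  show "partial (Inr d) (christoffel G (Inr c) (Inr a) (Inr b)) z = partial d (christoffel \<gamma> c a b) (vec_right z)"
    using partial_prod_Inr[OF DERIV_const diff_christoffel[OF zU], where c = d, of 1]
    by (simp add: cong)
qed

lemma T_trace: "T k k l = \<alpha> $ l" "T k l k = \<alpha> $ l"
  using eps[of k] by (auto simp: T_def algebra_simps)

text \<open>First use of nullity: the third term of \<open>T\<close> contracts \<open>\<alpha>\<close> with itself.\<close>

lemma sum_\<alpha>_T: "(\<Sum>l\<in>UNIV. \<alpha> $ l * T l i j) = 2 * \<alpha> $ i * \<alpha> $ j"
proof -
  have "(\<Sum>l\<in>UNIV. \<alpha> $ l * T l i j) = (\<Sum>l\<in>UNIV. if j = l then \<alpha> $ l * \<alpha> $ i else 0)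
      + (\<Sum>l\<in>UNIV. if i = l then \<alpha> $ l * \<alpha> $ j else 0)
      - (\<Sum>l\<in>UNIV. \<epsilon> $ l * (\<alpha> $ l)\<^sup>2) * (if i = j then \<epsilon> $ i else 0)"
    unfolding sum_distrib_right sum.distrib[symmetric] sum_subtractf[symmetric]
    by (intro sum.cong refl) (simp add: T_def algebra_simps power2_eq_square)
  then show ?thesis by (simp add: null)
qed

text \<open>Multiplying out \<open>T k j l\<close> and carrying out the sum over \<open>l\<close> first leaves three contractions of a single
  \<open>T\<close>: they contribute \<open>2\<close> (by \<open>sum_\<alpha>_T\<close>), \<open>CARD('n)\<close> (the trace) and \<open>0\<close>
  (one term by nullity, the other two cancel).\<close>

lemma sum_T_T: "(\<Sum>k\<in>UNIV. \<Sum>l\<in>UNIV. T k j l * T l i k) = (CARD('n) + 2) * \<alpha> $ i * \<alpha> $ j"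
proof -
  have inner: "(\<Sum>l\<in>UNIV. T k j l * T l i k) =
      (if j = k then (\<Sum>l\<in>UNIV. \<alpha> $ l * T l i k) else 0) + \<alpha> $ j * T k i k
      - \<epsilon> $ k * \<alpha> $ k * \<epsilon> $ j * T j i k" for k
  proof -
    have "(\<Sum>l\<in>UNIV. T k j l * T l i k) = (\<Sum>l\<in>UNIV. if j = k then \<alpha> $ l * T l i k else 0)
      + (\<Sum>l\<in>UNIV. if l = k then \<alpha> $ j * T l i k else 0)
      - (\<Sum>l\<in>UNIV. if l = j then \<epsilon> $ k * \<alpha> $ k * \<epsilon> $ j * T l i k else 0)"
      unfolding sum.distrib[symmetric] sum_subtractf[symmetric]
      by (intro sum.cong refl) (auto simp add: T_def[of k j] algebra_simps)
    then show ?thesis by (cases "j = k") simp_all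
  qed
  have zero: "(\<Sum>k\<in>UNIV. \<epsilon> $ k * \<alpha> $ k * T j i k) = 0"
  proof -
    have "(\<Sum>k\<in>UNIV. \<epsilon> $ k * \<alpha> $ k * T j i k) = (\<Sum>k\<in>UNIV. if j = k then \<epsilon> $ k * \<alpha> $ k * \<alpha> $ i else 0)
      + (\<Sum>k\<in>UNIV. \<epsilon> $ k * (\<alpha> $ k)\<^sup>2) * (if i = j then 1 else 0)
      - (\<Sum>k\<in>UNIV. if i = k then (\<epsilon> $ k * \<epsilon> $ k) * \<alpha> $ k * \<epsilon> $ j * \<alpha> $ j else 0)"
      unfolding sum_distrib_right sum.distrib[symmetric] sum_subtractf[symmetric]
      by (intro sum.cong refl) (auto simp add: T_def algebra_simps power2_eq_square)
    then show ?thesis by (simp add: null eps mult_ac)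
  qed
  have "(\<Sum>k\<in>UNIV. \<Sum>l\<in>UNIV. T k j l * T l i k) = (\<Sum>k\<in>UNIV. (if j = k then (\<Sum>l\<in>UNIV. \<alpha> $ l * T l i k) else 0) + \<alpha> $ j * T k i k
      - \<epsilon> $ k * \<alpha> $ k * \<epsilon> $ j * T j i k)"
    by (simp only: inner)
  also have "\<dots> = 2 * \<alpha> $ i * \<alpha> $ j + CARD('n) * \<alpha> $ i * \<alpha> $ j - \<epsilon> $ j * (\<Sum>k\<in>UNIV. \<epsilon> $ k * \<alpha> $ k * T j i k)"
    by (simp add: sum.distrib sum_subtractf sum_\<alpha>_T T_trace sum_distrib_left mult_ac)
  finally show ?thesis unfolding zero by (simp add: algebra_simps)
qed

text \<open>Each of the four kinds of terms of the Ricci tensor is a number times \<open>\<alpha>\<^sub>i \<alpha>\<^sub>j\<close>. Any such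
  tensor is traceless, so the scalar curvature does not see the factor.\<close>

lemma ricci_G_Inl:
  assumes z: "z \<in> V"
  shows "\<exists>K. \<forall>i j. ricci G (Inl i) (Inl j) z = K * \<alpha> $ i * \<alpha> $ j"
proof -
  define n m a a' b b' where "n = real CARD('n)" and "m = real CARD('m)"
    and "a = A (s z)" and "a' = deriv A (s z)" and "b = B (s z)" and "b' = deriv B (s z)"
  have "ricci G (Inl i) (Inl j) z =
      ((2 - n) * a' + (n - 2) * a\<^sup>2 + m * (2 * a * b - b' - b\<^sup>2)) * \<alpha> $ i * \<alpha> $ j" for i j
  proof -
    have base: "(\<Sum>k\<in>UNIV. a' * \<alpha> $ k * T k i j - a' * \<alpha> $ j * \<alpha> $ i
        + (\<Sum>l\<in>UNIV. a * \<alpha> $ l * (a * T l i j) - a * T k j l * (a * T l i k)))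
      = ((2 - n) * a' + (n - 2) * a\<^sup>2) * \<alpha> $ i * \<alpha> $ j"
    proof -
      have "(\<Sum>k\<in>UNIV. a' * \<alpha> $ k * T k i j - a' * \<alpha> $ j * \<alpha> $ i
          + (\<Sum>l\<in>UNIV. a * \<alpha> $ l * (a * T l i j) - a * T k j l * (a * T l i k)))
        = a' * (\<Sum>k\<in>UNIV. \<alpha> $ k * T k i j) - n * (a' * \<alpha> $ j * \<alpha> $ i)
          + a\<^sup>2 * (n * (\<Sum>l\<in>UNIV. \<alpha> $ l * T l i j)) - a\<^sup>2 * (\<Sum>k\<in>UNIV. \<Sum>l\<in>UNIV. T k j l * T l i k)"
        by (simp add: sum.distrib sum_subtractf sum_distrib_left n_def power2_eq_square mult_ac)
      then show ?thesis
        by (simp only: sum_\<alpha>_T sum_T_T) (simp add: n_def algebra_simps)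
    qed
    have fibre: "(\<Sum>c\<in>(UNIV::'m set). - (b' * \<alpha> $ j * \<alpha> $ i) + ((\<Sum>l\<in>UNIV. b * \<alpha> $ l * (a * T l i j))
        - (\<Sum>d\<in>UNIV. b * (\<alpha> $ j * (if c = d then 1 else 0)) * (b * (\<alpha> $ i * (if d = c then 1 else 0))))))
      = m * (2 * a * b - b' - b\<^sup>2) * \<alpha> $ i * \<alpha> $ j"
    proof -
      have "(\<Sum>d\<in>(UNIV::'m set). b * (\<alpha> $ j * (if c = d then 1 else 0)) * (b * (\<alpha> $ i * (if d = c then 1 else 0))))
        = (\<Sum>d\<in>UNIV. if d = c then b * \<alpha> $ j * (b * \<alpha> $ i) else 0)" for c
        by (intro sum.cong refl) auto
      moreover have "(\<Sum>l\<in>UNIV. b * \<alpha> $ l * (a * T l i j)) = a * b * (\<Sum>l\<in>UNIV. \<alpha> $ l * T l i j)"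
        by (simp add: sum_distrib_left mult_ac)
      ultimately show ?thesis
        by (simp add: sum_\<alpha>_T m_def power2_eq_square algebra_simps)
    qed
    have "ricci G (Inl i) (Inl j) z = (\<Sum>k\<in>UNIV. a' * \<alpha> $ k * T k i j - a' * \<alpha> $ j * \<alpha> $ i
        + (\<Sum>l\<in>UNIV. a * \<alpha> $ l * (a * T l i j) - a * T k j l * (a * T l i k)))
      + (\<Sum>c\<in>(UNIV::'m set). - (b' * \<alpha> $ j * \<alpha> $ i) + ((\<Sum>l\<in>UNIV. b * \<alpha> $ l * (a * T l i j))
        - (\<Sum>d\<in>UNIV. b * (\<alpha> $ j * (if c = d then 1 else 0)) * (b * (\<alpha> $ i * (if d = c then 1 else 0))))))"
      unfolding ricci_def sum_UNIV_Plus
      by (simp add: christoffel_G[OF z] partial_christoffel_G[OF z] T_trace a_def a'_def b_def b'_def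
        sum_negf)
    then show ?thesis unfolding base fibre by (simp add: algebra_simps)
  qed
  then show ?thesis by blast
qed

text \<open>Besides the terms of the Ricci tensor of \<open>\<gamma>\<close>, every other term pairs a factor \<open>\<epsilon>\<^sub>k \<alpha>\<^sub>k\<close>, from a
  symbol \<open>\<Gamma>\<^sup>k\<^sub>a\<^sub>b\<close> with \<open>k\<close> a base index, with a factor \<open>\<alpha>\<^sub>k\<close>, from a derivative or another symbol. Summing over \<open>k\<close>
  gives zero.\<close>

lemma ricci_G_Inr:
  assumes z: "z \<in> V"
  shows "ricci G (Inr a) (Inr b) z = ricci \<gamma> a b (vec_right z)"
proof -
  have null_sum: "(\<Sum>k\<in>UNIV. F k) = 0" if "\<And>k. F k = c * (\<epsilon> $ k * (\<alpha> $ k)\<^sup>2)" for F c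
    by (simp only: that sum_distrib_left[symmetric] null mult_zero_right)
  have null_sums:
    "(\<Sum>k\<in>UNIV. p * \<alpha> $ k * (q * (\<epsilon> $ k * \<alpha> $ k) * r)) = 0"
    "(\<Sum>k\<in>UNIV. p * (\<alpha> $ k * d) * (q * (\<epsilon> $ k * \<alpha> $ k) * r)) = 0"
    "(\<Sum>k\<in>UNIV. p * \<alpha> $ k * (\<epsilon> $ k * \<alpha> $ k * r)) = 0"
    "(\<Sum>k\<in>UNIV. q * (\<epsilon> $ k * \<alpha> $ k) * r * (p * \<alpha> $ k)) = 0" for p q r d
    by (rule null_sum[where c = "p * q * r"], simp add: power2_eq_square)
      (rule null_sum[where c = "p * q * r * d"], simp add: power2_eq_square,
       rule null_sum[where c = "p * r"], simp add: power2_eq_square,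
       rule null_sum[where c = "p * q * r"], simp add: power2_eq_square)
  have delta: "(\<Sum>j\<in>UNIV. q * x j * (p * (r * (if j = a then 1 else 0)))) = q * x a * (p * r)" for p q r and x :: "'m \<Rightarrow> real"
    by (simp add: if_distrib[of "\<lambda>x. _ * x"] cong: if_cong)
  show ?thesis
    unfolding ricci_def sum_UNIV_Plus
    by (simp add: christoffel_G[OF z] partial_christoffel_G[OF z] T_trace)
      (simp add: delta null_sums sum.distrib sum_subtractf sum_negf)
qed

text \<open>The inverse metric is block diagonal, so the trace of the Ricci tensor splits: the base part is \<open>K/u\<close>
  times the null contraction, the fibre part is \<open>1/w\<close> times the trace of the Ricci tensor of \<open>\<gamma>\<close>.\<close>

lemma scalar_curv_G:
  assumes z: "z \<in> V"
  shows "scalar_curv G z = scalar_curv \<gamma> (vec_right z) / w (s z)"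
proof -
  obtain K where K: "\<And>i j. ricci G (Inl i) (Inl j) z = K * \<alpha> $ i * \<alpha> $ j"
    using ricci_G_Inl[OF z] by blast
  have "(\<Sum>i\<in>UNIV. \<Sum>j\<in>UNIV. matrix_inv (G z) $ Inl i $ Inl j * ricci G (Inl i) (Inl j) z)
      = (\<Sum>i\<in>UNIV. \<Sum>j\<in>UNIV. if i = j then K / u (s z) * (\<epsilon> $ i * (\<alpha> $ i)\<^sup>2) else 0)"
    by (intro sum.cong refl) (auto simp: matrix_inv_G_nth[OF z] K power2_eq_square)
  also have "\<dots> = K / u (s z) * (\<Sum>i\<in>UNIV. \<epsilon> $ i * (\<alpha> $ i)\<^sup>2)"
    by (simp add: sum_distrib_left)
  finally have "(\<Sum>i\<in>UNIV. \<Sum>j\<in>UNIV. matrix_inv (G z) $ Inl i $ Inl j * ricci G (Inl i) (Inl j) z) = 0"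
    by (simp add: null)
  then show ?thesis
    unfolding scalar_curv_def sum_UNIV_Plus
    by (simp add: matrix_inv_G_nth[OF z] ricci_G_Inr[OF z] sum_divide_distrib sum.distrib)
qed

text \<open>The fibre components are multiples of the derivative of \<open>w\<close> along the gradient of \<open>h\<close>. That
  gradient is null, hence annihilates every function of \<open>\<alpha> \<bullet> x\<close>. In the base components nullity
  removes the diagonal term of \<open>T\<close>, so that only a multiple of \<open>\<alpha>\<^sub>i \<alpha>\<^sub>j\<close> is left.\<close>

lemma hessian_G:
  fixes h :: "real \<Rightarrow> real"
  assumes z: "z \<in> V" and h: "smooth_on UNIV h"
  shows "hessian G (\<lambda>z. h (s z)) (Inl i) (Inl j) z
      = (deriv (deriv h) (s z) - 2 * A (s z) * deriv h (s z)) * \<alpha> $ i * \<alpha> $ j"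
    "hessian G (\<lambda>z. h (s z)) (Inl i) (Inr b) z = 0"
    "hessian G (\<lambda>z. h (s z)) (Inr a) (Inl j) z = 0"
    "hessian G (\<lambda>z. h (s z)) (Inr a) (Inr b) z = 0"
proof -
  note dh = has_real_derivative_smooth[OF h] has_real_derivative_smooth[OF smooth_deriv[OF h]]
  have d: "partial (Inl j) (\<lambda>z. h (s z)) = (\<lambda>z. deriv h (s z) * \<alpha> $ j)"
    "partial (Inr b) (\<lambda>z. h (s z)) = (\<lambda>z. 0)" for j b
    using partial_ridge[OF dh(1), where c = 1] by (auto simp: fun_eq_iff)
  have "(\<Sum>k\<in>UNIV. A (s z) * T k i j * (deriv h (s z) * \<alpha> $ k))
      = A (s z) * deriv h (s z) * (\<Sum>k\<in>UNIV. \<alpha> $ k * T k i j)"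
    by (simp add: sum_distrib_left mult_ac)
  then show "hessian G (\<lambda>z. h (s z)) (Inl i) (Inl j) z
      = (deriv (deriv h) (s z) - 2 * A (s z) * deriv h (s z)) * \<alpha> $ i * \<alpha> $ j"
    unfolding hessian_def sum_UNIV_Plus d partial_ridge_Inl[OF dh(2)] christoffel_G[OF z] sum_\<alpha>_T
    by (simp add: algebra_simps)
  have "(\<Sum>k\<in>UNIV. C (s z) * (- \<epsilon> $ k * \<alpha> $ k) * \<gamma> (vec_right z) $ a $ b * (deriv h (s z) * \<alpha> $ k))
      = - C (s z) * \<gamma> (vec_right z) $ a $ b * deriv h (s z) * (\<Sum>k\<in>UNIV. \<epsilon> $ k * (\<alpha> $ k)\<^sup>2)"
    unfolding sum_distrib_left by (intro sum.cong refl) (simp add: power2_eq_square)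
  then show "hessian G (\<lambda>z. h (s z)) (Inr a) (Inr b) z = 0"
    unfolding hessian_def sum_UNIV_Plus d christoffel_G[OF z] by (simp add: null)
  show "hessian G (\<lambda>z. h (s z)) (Inl i) (Inr b) z = 0"
    "hessian G (\<lambda>z. h (s z)) (Inr a) (Inl j) z = 0"
    unfolding hessian_def sum_UNIV_Plus d christoffel_G[OF z]
    by (simp_all add: partial_ridge_Inr[OF dh(2)])
qed

text \<open>Since \<open>\<alpha>\<close> has a nonzero component, one base component of the Hessian already determines whether
  all of them vanish.\<close>

lemma hessian_G_eq_0_iff:
  fixes h :: "real \<Rightarrow> real"
  assumes "\<alpha> \<noteq> 0" and z: "z \<in> V" and h: "smooth_on UNIV h"
  shows "(\<forall>k l. hessian G (\<lambda>z. h (s z)) k l z = 0)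
    \<longleftrightarrow> u (s z) * deriv (deriv h) (s z) = deriv u (s z) * deriv h (s z)" (is "?L \<longleftrightarrow> ?R")
proof -
  obtain i where i: "\<alpha> $ i \<noteq> 0" using assms(1) by (auto simp: vec_eq_iff)
  have "?R \<longleftrightarrow> deriv (deriv h) (s z) - 2 * A (s z) * deriv h (s z) = 0"
    using u(2)[of "s z"] by (auto simp: A_def field_simps)
  moreover have "?L" if "deriv (deriv h) (s z) - 2 * A (s z) * deriv h (s z) = 0"
  proof (intro allI)
    show "hessian G (\<lambda>z. h (s z)) k l z = 0" for k l
      by (cases k; cases l) (simp_all only: hessian_G[OF z h] that mult_zero_left)
  qed
  moreover have "deriv (deriv h) (s z) - 2 * A (s z) * deriv h (s z) = 0" if ?L
    using that[rule_format, of "Inl i" "Inl i"] i unfolding hessian_G[OF z h] by simp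
  ultimately show ?thesis by blast
qed

end

section \<open>Charts and semi-Riemannian metrics\<close>

text \<open>The rectangles formed from two countable bases are a countable basis of the product.\<close>

lemma second_countable_prod_topology:
  assumes "second_countable X" "second_countable Y"
  shows "second_countable (prod_topology X Y)"
proof -
  obtain A where A: "countable A" "\<And>S. S \<in> A \<Longrightarrow> openin X S"
    "\<And>U x. openin X U \<Longrightarrow> x \<in> U \<Longrightarrow> \<exists>S\<in>A. x \<in> S \<and> S \<subseteq> U"
    using assms(1) unfolding second_countable_def by metis
  obtain B where B: "countable B" "\<And>S. S \<in> B \<Longrightarrow> openin Y S"
    "\<And>U x. openin Y U \<Longrightarrow> x \<in> U \<Longrightarrow> \<exists>S\<in>B. x \<in> S \<and> S \<subseteq> U"
    using assms(2) unfolding second_countable_def by metis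
  let ?C = "(\<lambda>(S, T). S \<times> T) ` (A \<times> B)"
  have "countable ?C" using A(1) B(1) by auto
  moreover have "\<forall>W\<in>?C. openin (prod_topology X Y) W"
    using A(2) B(2) by (auto simp: openin_prod_Times_iff)
  moreover have "\<exists>W\<in>?C. p \<in> W \<and> W \<subseteq> U" if U: "openin (prod_topology X Y) U" and p: "p \<in> U" for U p
  proof -
    obtain x y where xy: "p = (x, y)" by (cases p)
    obtain S T where "openin X S" "openin Y T" "x \<in> S" "y \<in> T" and ST: "S \<times> T \<subseteq> U"
      using U p unfolding openin_prod_topology_alt xy by metis
    then obtain S' T' where "S' \<in> A" "x \<in> S'" "S' \<subseteq> S" "T' \<in> B" "y \<in> T'" "T' \<subseteq> T"
      using A(3) B(3) by metis
    then have "S' \<times> T' \<in> ?C" "p \<in> S' \<times> T'" "S' \<times> T' \<subseteq> U"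
      using ST xy by blast+
    then show ?thesis by blast
  qed
  ultimately show ?thesis unfolding second_countable_def by (intro exI[of _ ?C] conjI allI impI) simp_all
qed

lemma second_countable_euclidean: "second_countable (euclidean :: 'a::second_countable_topology topology)"
proof -
  obtain A :: "'a set set" where A: "countable A" "topological_basis A"
    using ex_countable_basis by blast
  then show ?thesis
    unfolding second_countable_def
    by (intro exI[of _ A]) (auto simp: topological_basis_open elim!: topological_basisE)
qed

lemma
  assumes "smooth_manifold M" "a \<in> chart_ix M"
  shows openin_chart_dom: "openin (mtop M) (chart_dom M a)"
    and open_chart_image: "open (chart_image M a)"
    and homeomorphic_chart_map: "homeomorphic_map (subtopology (mtop M) (chart_dom M a))
      (top_of_set (chart_image M a)) (chart_map M a)"
  using assms by (auto simp: smooth_manifold_def)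

lemma topspace_chart_dom:
  assumes "smooth_manifold M" "a \<in> chart_ix M"
  shows "topspace (subtopology (mtop M) (chart_dom M a)) = chart_dom M a"
  using openin_subset[OF openin_chart_dom[OF assms]] by auto

lemma inj_on_chart_map:
  assumes "smooth_manifold M" "a \<in> chart_ix M"
  shows "inj_on (chart_map M a) (chart_dom M a)"
  using homeomorphic_imp_injective_map[OF homeomorphic_chart_map[OF assms]]
    topspace_chart_dom[OF assms] by simp

lemma chart_inv_chart_map:
  assumes "smooth_manifold M" "a \<in> chart_ix M" "p \<in> chart_dom M a"
  shows "chart_inv M a (chart_map M a p) = p"
  using inj_on_chart_map[OF assms(1,2)] assms(3) by (simp add: chart_inv_def)

lemma open_overlap:
  assumes M: "smooth_manifold M" and ab: "a \<in> chart_ix M" "b \<in> chart_ix M"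
  shows "open (overlap M a b)"
proof -
  have "openin (subtopology (mtop M) (chart_dom M a)) (chart_dom M a \<inter> chart_dom M b)"
    using openin_chart_dom[OF M ab(2)] by (auto simp: openin_subtopology)
  then have "openin (top_of_set (chart_image M a)) (overlap M a b)"
    using homeomorphic_imp_open_map[OF homeomorphic_chart_map[OF M ab(1)]]
    by (auto simp: open_map_def overlap_def)
  then show ?thesis using open_chart_image[OF M ab(1)] openin_open_trans by blast
qed

lemma overlap_subset: "overlap M a b \<subseteq> chart_image M a"
  by (auto simp: overlap_def chart_image_def)

text \<open>Both charts describe the same point; this makes functions on the manifold agree in
  overlapping charts.\<close>

lemma transition_overlap:
  assumes "smooth_manifold M" "a \<in> chart_ix M" "b \<in> chart_ix M" "y \<in> overlap M a b"
  shows "chart_inv M b (transition M a b y) = chart_inv M a y"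
    and "transition M a b y \<in> chart_image M b"
  using assms(4) chart_inv_chart_map[OF assms(1,2)] chart_inv_chart_map[OF assms(1,3)]
  by (auto simp: overlap_def transition_def chart_image_def)

lemma smooth_transition:
  assumes "smooth_manifold M" "a \<in> chart_ix M" "b \<in> chart_ix M"
  shows "smooth_on (overlap M a b) (transition M a b)"
  using assms by (auto simp: smooth_manifold_def)

lemma chart_inv_pseudo_euclidean: "chart_inv (pseudo_euclidean \<epsilon>) a = (\<lambda>y. y)"
  by (auto simp: pseudo_euclidean_def chart_inv_def inv_into_def)

lemma
  assumes "semi_riemannian M"
  shows semi_riemannian_manifold: "smooth_manifold M"
    and smooth_metric_tensor: "a \<in> chart_ix M \<Longrightarrow> smooth_on (chart_image M a) (\<lambda>y. metric_tensor M a y $ i $ j)"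
    and metric_tensor_transition: "a \<in> chart_ix M \<Longrightarrow> b \<in> chart_ix M \<Longrightarrow> y \<in> overlap M a b \<Longrightarrow>
      J = matrix (frechet_derivative (transition M a b) (at y)) \<Longrightarrow>
      metric_tensor M a y = transpose J ** metric_tensor M b (transition M a b y) ** J"
    and transpose_metric_tensor: "a \<in> chart_ix M \<Longrightarrow> y \<in> chart_image M a \<Longrightarrow>
      transpose (metric_tensor M a y) = metric_tensor M a y"
    and invertible_metric_tensor: "a \<in> chart_ix M \<Longrightarrow> y \<in> chart_image M a \<Longrightarrow> invertible (metric_tensor M a y)"
    and index_metric_tensor:
      "\<exists>q. \<forall>a\<in>chart_ix M. \<forall>y\<in>chart_image M a. has_index (metric_tensor M a y) q"
  using assms unfolding semi_riemannian_def Let_def by blast+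

text \<open>An orthonormal basis for \<open>D\<close>, divided by \<open>sqrt c\<close>, is orthonormal for \<open>c *\<^sub>R D\<close>.\<close>

lemma has_index_scaleR:
  fixes D :: "real^'k^'k::finite"
  assumes "has_index D q" "0 < c"
  shows "has_index (c *\<^sub>R D) q"
proof -
  obtain P :: "real^'k^'k" and e where P: "invertible P" "\<forall>i. e $ i \<in> {-1, 1}"
    "transpose P ** D ** P = diag_matrix e" "card {i. e $ i = -1} = q"
    using assms(1) unfolding has_index_def by blast
  define r where "r = 1 / sqrt c"
  have r: "r * r * c = 1" "r \<noteq> 0" using assms(2) by (simp_all add: r_def)
  have "invertible (r *\<^sub>R P)"
  proof -
    obtain P' where "P ** P' = mat 1" "P' ** P = mat 1" using P(1) invertible_def by blast
    then have "(r *\<^sub>R P) ** ((1 / r) *\<^sub>R P') = mat 1 \<and> ((1 / r) *\<^sub>R P') ** (r *\<^sub>R P) = mat 1"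
      using r by (simp add: scaleR_matrix_mult)
    then show ?thesis unfolding invertible_def by blast
  qed
  moreover have "transpose (r *\<^sub>R P) ** (c *\<^sub>R D) ** (r *\<^sub>R P) = diag_matrix e"
  proof -
    have "transpose (r *\<^sub>R P) = r *\<^sub>R transpose P" by (simp add: transpose_def vec_eq_iff)
    moreover have "r * c * r = 1" using r by (simp add: mult_ac)
    ultimately show ?thesis using P(3) by (simp add: scaleR_matrix_mult)
  qed
  ultimately show ?thesis unfolding has_index_def using P(2,4) by blast
qed

text \<open>Orthonormal bases of the two blocks together form one of the sum.\<close>

lemma has_index_block_diag:
  fixes A :: "real^'b^'b::finite" and D :: "real^'m^'m::finite"
  assumes "has_index A p" "has_index D q"
  shows "has_index (block_diag A D) (p + q)"
proof -
  obtain P :: "real^'b^'b" and e where P: "invertible P" "\<forall>i. e $ i \<in> {-1, 1}"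
    "transpose P ** A ** P = diag_matrix e" "card {i. e $ i = -1} = p"
    using assms(1) unfolding has_index_def by blast
  obtain Q :: "real^'m^'m" and d where Q: "invertible Q" "\<forall>i. d $ i \<in> {-1, 1}"
    "transpose Q ** D ** Q = diag_matrix d" "card {i. d $ i = -1} = q"
    using assms(2) unfolding has_index_def by blast
  have "{i. vec_join e d $ i = -1} = {i. e $ i = -1} <+> {i. d $ i = -1}"
  proof (intro set_eqI)
    show "k \<in> {i. vec_join e d $ i = -1} \<longleftrightarrow> k \<in> {i. e $ i = -1} <+> {i. d $ i = -1}" for k
      by (cases k) auto
  qed
  then have "card {i. vec_join e d $ i = -1} = p + q"
    using P(4) Q(4) by (simp add: card_Plus)
  moreover have "vec_join e d $ k \<in> {-1, 1}" for k
    using P(2) Q(2) by (cases k) auto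
  moreover have "transpose (block_diag P Q) ** block_diag A D ** block_diag P Q = diag_matrix (vec_join e d)"
    by (simp add: transpose_block_diag block_diag_mult P(3) Q(3)) (simp add: vec_sum_eq_iff diag_matrix_def)
  ultimately show ?thesis
    unfolding has_index_def using invertible_block_diag[OF P(1) Q(1)] by blast
qed

section \<open>Conformal metrics\<close>

lemma semi_riemannian_pseudo_euclidean:
  fixes \<epsilon> :: "real^'n::finite"
  assumes "\<forall>i. \<epsilon> $ i \<in> {-1, 1}"
  shows "semi_riemannian (pseudo_euclidean \<epsilon>)"
proof -
  let ?E = "pseudo_euclidean \<epsilon>"
  have [simp]: "mtop ?E = euclidean" "chart_ix ?E = UNIV" "chart_dom ?E a = UNIV" "chart_map ?E a x = x"
    "metric_tensor ?E a y = diag_matrix \<epsilon>" for a x y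
    by (simp_all add: pseudo_euclidean_def)
  have [simp]: "chart_inv ?E a = (\<lambda>y. y)" for a by (simp add: chart_inv_pseudo_euclidean)
  have [simp]: "chart_image ?E a = UNIV" "transition ?E a b = (\<lambda>y. y)" for a b
    by (simp_all add: chart_image_def transition_def fun_eq_iff)
  have [simp]: "overlap ?E a b = UNIV" for a b by (simp add: overlap_def)
  have "homeomorphic_map euclidean euclidean (chart_map ?E a)" for a
    using homeomorphic_map_id[of euclidean euclidean] by (simp add: id_def pseudo_euclidean_def)
  then have M: "smooth_manifold ?E"
    by (auto simp: smooth_manifold_def second_countable_euclidean
      intro: smooth_on_bounded_linear[OF bounded_linear_ident])
  have e: "\<epsilon> $ i * \<epsilon> $ i = 1" for i using assms[rule_format, of i] by auto
  have inv: "invertible (diag_matrix \<epsilon>)"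
    unfolding invertible_def
    by (rule exI[of _ "diag_matrix \<epsilon>"]) (simp add: diag_matrix_mult e mat_eq_diag_matrix)
  have "has_index (diag_matrix \<epsilon>) (card {i. \<epsilon> $ i = -1})"
    unfolding has_index_def
    using assms by (intro exI[of _ "mat 1"] exI[of _ \<epsilon>]) (simp add: transpose_mat invertible_def exI[of _ "mat 1"])
  moreover have "transpose (diag_matrix \<epsilon>) = diag_matrix \<epsilon>"
    by (simp add: transpose_def diag_matrix_def vec_eq_iff)
  moreover have "matrix (\<lambda>y::real^'n. y) = mat 1"
    by (simp add: matrix_def mat_def axis_def vec_eq_iff)
  ultimately show ?thesis
    using M inv by (auto simp: semi_riemannian_def smooth_on_const transpose_mat Let_def)
qed

lemma smooth_function_pseudo_euclidean:
  assumes "smooth_on UNIV k"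
  shows "smooth_function (pseudo_euclidean \<epsilon>) k"
proof -
  have "chart_image (pseudo_euclidean \<epsilon>) a = UNIV" for a
    by (simp add: chart_image_def pseudo_euclidean_def)
  then show ?thesis
    using assms by (simp add: smooth_function_def chart_inv_pseudo_euclidean o_def)
qed

text \<open>The conformal factor is a function on the manifold, hence the same in two charts at the same point, and
  being positive it preserves the index.\<close>

lemma semi_riemannian_conformal_metric:
  fixes M :: "('p, 'c, 'i::finite) metric_manifold"
  assumes M: "semi_riemannian M" and v: "smooth_function M v" "\<And>p. v p > 0"
  shows "semi_riemannian (conformal_metric v M)"
proof -
  let ?C = "conformal_metric v M"
  have fields [simp]: "mtop ?C = mtop M" "chart_ix ?C = chart_ix M" "chart_dom ?C = chart_dom M" "chart_map ?C = chart_map M"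
    "metric_tensor ?C a y = v (chart_inv M a y) *\<^sub>R metric_tensor M a y" for a y
    by (simp_all add: conformal_metric_def)
  have charts [simp]: "chart_inv ?C = chart_inv M" "chart_image ?C = chart_image M"
    "transition ?C = transition M" "overlap ?C = overlap M"
    by (simp_all add: chart_inv_def[abs_def] chart_image_def[abs_def] transition_def[abs_def] overlap_def[abs_def])
  note m = semi_riemannian_manifold[OF M]
  have "smooth_manifold ?C" using m unfolding smooth_manifold_def fields charts .
  moreover have "smooth_on (chart_image M a) (\<lambda>y. v (chart_inv M a y) * metric_tensor M a y $ i $ j)"
    if "a \<in> chart_ix M" for a i j
    using that v(1) open_chart_image[OF m that]
    by (intro smooth_on_mult smooth_metric_tensor[OF M]) (auto simp: smooth_function_def o_def)
  moreover have "v (chart_inv M a y) *\<^sub>R metric_tensor M a y =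
      transpose J ** (v (chart_inv M b (transition M a b y)) *\<^sub>R metric_tensor M b (transition M a b y)) ** J"
    if "a \<in> chart_ix M" "b \<in> chart_ix M" "y \<in> overlap M a b"
      and J: "J = matrix (frechet_derivative (transition M a b) (at y))" for a b y J
    using metric_tensor_transition[OF M that]
    by (simp add: transition_overlap(1)[OF m that(1-3)] scaleR_congruence)
  moreover have "\<exists>q. \<forall>a\<in>chart_ix M. \<forall>y\<in>chart_image M a.
      has_index (v (chart_inv M a y) *\<^sub>R metric_tensor M a y) q"
    using index_metric_tensor[OF M] has_index_scaleR v(2) by blast
  moreover have "transpose (v (chart_inv M a y) *\<^sub>R metric_tensor M a y) = v (chart_inv M a y) *\<^sub>R metric_tensor M a y \<and>
      invertible (v (chart_inv M a y) *\<^sub>R metric_tensor M a y)"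
    if "a \<in> chart_ix M" "y \<in> chart_image M a" for a y
  proof -
    have "transpose (c *\<^sub>R X) = c *\<^sub>R transpose X" for c and X :: "real^'i^'i"
      by (simp add: transpose_def vec_eq_iff)
    then show ?thesis
      using invertible_scaleR[OF invertible_metric_tensor[OF M that]] transpose_metric_tensor[OF M that]
        v(2)[of "chart_inv M a y"] by auto
  qed
  ultimately show ?thesis
    unfolding semi_riemannian_def fields charts Let_def vector_scaleR_component real_scaleR_def by blast
qed

section \<open>Warped products\<close>

lemma warped_product_fields [simp]:
  "mtop (warped_product M f N) = prod_topology (mtop M) (mtop N)"
  "chart_ix (warped_product M f N) = chart_ix M \<times> chart_ix N"
  "chart_dom (warped_product M f N) (a, b) = chart_dom M a \<times> chart_dom N b"
  "chart_map (warped_product M f N) (a, b) (p, q) = vec_join (chart_map M a p) (chart_map N b q)"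
  "metric_tensor (warped_product M f N) (a, b) z = block_diag (metric_tensor M a (vec_left z))
     ((f (chart_inv M a (vec_left z)))\<^sup>2 *\<^sub>R metric_tensor N b (vec_right z))"
  by (simp_all add: warped_product_def)

lemma image_vec_join: "(\<lambda>(x, y). vec_join x y) ` (S \<times> T) = {z. vec_left z \<in> S \<and> vec_right z \<in> T}"
proof (intro equalityI subsetI)
  fix z assume "z \<in> {z. vec_left z \<in> S \<and> vec_right z \<in> T}"
  then show "z \<in> (\<lambda>(x, y). vec_join x y) ` (S \<times> T)"
    by (intro image_eqI[of _ _ "(vec_left z, vec_right z)"]) auto
qed auto

lemma warped_product_image:
  "chart_map (warped_product M f N) (a, b) ` (P \<times> Q)
    = {z. vec_left z \<in> chart_map M a ` P \<and> vec_right z \<in> chart_map N b ` Q}"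
proof -
  have "chart_map (warped_product M f N) (a, b) ` (P \<times> Q)
      = (\<lambda>(x, y). vec_join x y) ` (chart_map M a ` P \<times> chart_map N b ` Q)"
    by (force simp: image_iff)
  then show ?thesis by (simp only: image_vec_join)
qed

lemma chart_image_warped_product:
  "chart_image (warped_product M f N) (a, b) = {z. vec_left z \<in> chart_image M a \<and> vec_right z \<in> chart_image N b}"
  by (simp add: chart_image_def warped_product_image)

lemma overlap_warped_product:
  "overlap (warped_product M f N) (a, b) (a', b') = {z. vec_left z \<in> overlap M a a' \<and> vec_right z \<in> overlap N b b'}"
  by (simp add: overlap_def Times_Int_Times warped_product_image)

lemma open_vec_product:
  assumes "open S" "open T"
  shows "open {z. vec_left z \<in> S \<and> vec_right z \<in> T}"
proof -
  have "open (vec_left -` S \<inter> vec_right -` T)"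
    using assms by (intro open_Int open_vimage linear_continuous_on bounded_linear_vec_left bounded_linear_vec_right)
  then show ?thesis by (simp add: vimage_def Int_def)
qed

text \<open>Identifies a product of coordinate domains, with the product topology, with a subset of the coordinate space of the product,
  so that product charts are compositions of homeomorphisms.\<close>

lemma homeomorphic_maps_vec_join:
  "homeomorphic_maps (top_of_set (S \<times> T)) (top_of_set {z. vec_left z \<in> S \<and> vec_right z \<in> T})
     (\<lambda>(x, y). vec_join x y) (\<lambda>z. (vec_left z, vec_right z))"
proof -
  have "linear (\<lambda>p. vec_join (fst p) (snd p))"
    by (auto intro!: linearI simp: vec_sum_eq_iff)
  then have "continuous_on (S \<times> T) (\<lambda>p. vec_join (fst p) (snd p))"
    by (intro linear_continuous_on) (simp add: linear_conv_bounded_linear)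
  moreover have "continuous_on X (\<lambda>z. (vec_left z, vec_right z))" for X
    by (intro continuous_on_Pair linear_continuous_on bounded_linear_vec_left bounded_linear_vec_right)
  ultimately show ?thesis
    by (auto simp: homeomorphic_maps_def case_prod_unfold)
qed

text \<open>Restricted to the chart image because \<open>chart_inv\<close> is an arbitrary choice elsewhere.\<close>

lemma chart_inv_warped_product:
  assumes M: "smooth_manifold M" "a \<in> chart_ix M" and N: "smooth_manifold N" "b \<in> chart_ix N"
    and z: "z \<in> chart_image (warped_product M f N) (a, b)"
  shows "chart_inv (warped_product M f N) (a, b) z = (chart_inv M a (vec_left z), chart_inv N b (vec_right z))"
proof -
  let ?W = "warped_product M f N"
  obtain p q where p: "p \<in> chart_dom M a" "vec_left z = chart_map M a p"
    and q: "q \<in> chart_dom N b" "vec_right z = chart_map N b q"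
    using z unfolding chart_image_warped_product by (auto simp: chart_image_def)
  have "inj_on (chart_map ?W (a, b)) (chart_dom ?W (a, b))"
  proof (rule inj_onI)
    fix r r' assume r: "r \<in> chart_dom ?W (a, b)" "r' \<in> chart_dom ?W (a, b)"
      and eq: "chart_map ?W (a, b) r = chart_map ?W (a, b) r'"
    then have "chart_map M a (fst r) = chart_map M a (fst r')" "chart_map N b (snd r) = chart_map N b (snd r')"
      by (cases r, cases r', simp, metis vec_left_join vec_right_join)+
    then show "r = r'"
      using r inj_onD[OF inj_on_chart_map[OF M]] inj_onD[OF inj_on_chart_map[OF N]]
      by (cases r, cases r') auto
  qed
  moreover have "chart_map ?W (a, b) (p, q) = z"
    by (simp flip: p(2) q(2))
  ultimately have "chart_inv ?W (a, b) z = (p, q)"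
    using p(1) q(1) unfolding chart_inv_def by (intro inv_into_f_eq) auto
  then show ?thesis
    by (simp add: p(2) q(2) chart_inv_chart_map[OF M p(1)] chart_inv_chart_map[OF N q(1)])
qed

lemma transition_warped_product:
  assumes M: "smooth_manifold M" "a \<in> chart_ix M" and N: "smooth_manifold N" "b \<in> chart_ix N"
    and z: "z \<in> chart_image (warped_product M f N) (a, b)"
  shows "transition (warped_product M f N) (a, b) (a', b') z
    = vec_join (transition M a a' (vec_left z)) (transition N b b' (vec_right z))"
  by (simp add: transition_def chart_inv_warped_product[OF M N z])

lemma bounded_linear_vec_join_left: "bounded_linear (\<lambda>x::real^'b::finite. vec_join x (0::real^'m::finite))"
  and bounded_linear_vec_join_right: "bounded_linear (\<lambda>y::real^'m::finite. vec_join (0::real^'b::finite) y)"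
  by (auto simp: linear_conv_bounded_linear[symmetric] vec_sum_eq_iff intro!: linearI)

lemma vec_join_eq_add: "vec_join x y = vec_join x 0 + vec_join 0 y"
  by (simp add: vec_sum_eq_iff)

lemma smooth_on_vec_left:
  assumes "smooth_on S v" "open S" "open R" "vec_left ` R \<subseteq> S"
  shows "smooth_on R (\<lambda>z. v (vec_left z))"
  by (rule smooth_on_compose_linear[OF bounded_linear_vec_left assms(2,1,3,4)])

lemma smooth_on_vec_right:
  assumes "smooth_on S v" "open S" "open R" "vec_right ` R \<subseteq> S"
  shows "smooth_on R (\<lambda>z. v (vec_right z))"
  by (rule smooth_on_compose_linear[OF bounded_linear_vec_right assms(2,1,3,4)])

lemma smooth_on_vec_join:
  fixes v :: "real^'b::finite \<Rightarrow> real^'b" and w :: "real^'m::finite \<Rightarrow> real^'m"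
  assumes v: "smooth_on S v" "open S" and w: "smooth_on T w" "open T"
  shows "smooth_on {z. vec_left z \<in> S \<and> vec_right z \<in> T} (\<lambda>z. vec_join (v (vec_left z)) (w (vec_right z)))"
proof -
  note R = open_vec_product[OF v(2) w(2)]
  show ?thesis
    unfolding vec_join_eq_add[of "v _" "w _"]
    by (intro smooth_on_add[OF R] smooth_on_linear_compose[OF bounded_linear_vec_join_left R]
        smooth_on_linear_compose[OF bounded_linear_vec_join_right R]
        smooth_on_vec_left[OF v R] smooth_on_vec_right[OF w R]) auto
qed

lemma smooth_manifold_warped_product:
  assumes M: "smooth_manifold M" and N: "smooth_manifold N"
  shows "smooth_manifold (warped_product M f N)"
proof -
  let ?W = "warped_product M f N"
  have ne: "topspace (mtop M) \<noteq> {}" "topspace (mtop N) \<noteq> {}"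
    and cov: "topspace (mtop M) = (\<Union>a\<in>chart_ix M. chart_dom M a)" "topspace (mtop N) = (\<Union>a\<in>chart_ix N. chart_dom N a)"
    using M N unfolding smooth_manifold_def by blast+
  have "topspace (mtop ?W) \<noteq> {}"
    using ne by auto
  moreover have "Hausdorff_space (mtop ?W)" "second_countable (mtop ?W)"
    using M N by (auto simp: smooth_manifold_def Hausdorff_space_prod_topology second_countable_prod_topology)
  moreover have "topspace (mtop ?W) = (\<Union>c\<in>chart_ix ?W. chart_dom ?W c)"
    using cov by auto
  moreover have "openin (mtop ?W) (chart_dom ?W c) \<and> open (chart_image ?W c) \<and>
      homeomorphic_map (subtopology (mtop ?W) (chart_dom ?W c)) (top_of_set (chart_image ?W c)) (chart_map ?W c)"
    if c: "c \<in> chart_ix ?W" for c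
  proof -
    obtain a b where ab: "c = (a, b)" "a \<in> chart_ix M" "b \<in> chart_ix N" using c by auto
    obtain m where m: "homeomorphic_maps (subtopology (mtop M) (chart_dom M a)) (top_of_set (chart_image M a)) (chart_map M a) m"
      using homeomorphic_chart_map[OF M ab(2)] homeomorphic_map_maps by blast
    obtain n where n: "homeomorphic_maps (subtopology (mtop N) (chart_dom N b)) (top_of_set (chart_image N b)) (chart_map N b) n"
      using homeomorphic_chart_map[OF N ab(3)] homeomorphic_map_maps by blast
    have "homeomorphic_maps (subtopology (mtop ?W) (chart_dom ?W c)) (top_of_set (chart_image M a \<times> chart_image N b))
        (\<lambda>(p, q). (chart_map M a p, chart_map N b q)) (\<lambda>(x, y). (m x, n y))"
      using m n by (simp add: ab(1) subtopology_Times homeomorphic_maps_prod flip: prod_topology_subtopology_eu)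
    from homeomorphic_maps_compose[OF conjI[OF this homeomorphic_maps_vec_join]]
    have "homeomorphic_map (subtopology (mtop ?W) (chart_dom ?W c)) (top_of_set (chart_image ?W c))
        ((\<lambda>(x, y). vec_join x y) \<circ> (\<lambda>(p, q). (chart_map M a p, chart_map N b q)))"
      unfolding ab(1) chart_image_warped_product by (rule homeomorphic_maps_imp_map)
    moreover have "(\<lambda>(x, y). vec_join x y) \<circ> (\<lambda>(p, q). (chart_map M a p, chart_map N b q)) = chart_map ?W c"
      by (auto simp: ab(1) fun_eq_iff)
    ultimately show ?thesis
      using openin_chart_dom[OF M ab(2)] openin_chart_dom[OF N ab(3)] open_chart_image[OF M ab(2)] open_chart_image[OF N ab(3)]
      by (simp add: ab(1) openin_prod_Times_iff chart_image_warped_product open_vec_product)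
  qed
  moreover have "smooth_on (overlap ?W c c') (transition ?W c c')"
    if c: "c \<in> chart_ix ?W" "c' \<in> chart_ix ?W" for c c'
  proof -
    obtain a b where ab: "c = (a, b)" "a \<in> chart_ix M" "b \<in> chart_ix N" using c by auto
    obtain a' b' where ab': "c' = (a', b')" "a' \<in> chart_ix M" "b' \<in> chart_ix N" using c by auto
    have R: "open (overlap ?W c c')"
      unfolding ab(1) ab'(1) overlap_warped_product
      by (intro open_vec_product open_overlap M N ab ab')
    have tr: "transition ?W c c' z = vec_join (transition M a a' (vec_left z)) (transition N b b' (vec_right z))"
      if "z \<in> overlap ?W c c'" for z
      using subsetD[OF overlap_subset that] unfolding ab(1) ab'(1) by (intro transition_warped_product M N ab)
    have "smooth_on (overlap ?W c c') (\<lambda>z. vec_join (transition M a a' (vec_left z)) (transition N b b' (vec_right z)))"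
      unfolding ab(1) ab'(1) overlap_warped_product
      by (intro smooth_on_vec_join smooth_transition open_overlap M N ab ab')
    then show ?thesis using smooth_on_cong[OF R, where u = "transition ?W c c'", OF tr] by simp
  qed
  ultimately show ?thesis unfolding smooth_manifold_def by blast
qed

text \<open>All conditions hold blockwise. In the change of charts the Jacobian is block diagonal, and the
  factor \<open>f\<^sup>2\<close> is the same in both charts because it is evaluated at the same point of the base. The index
  is the sum of the two indices.\<close>

lemma semi_riemannian_warped_product:
  fixes M :: "('p, 'c, 'b::finite) metric_manifold" and N :: "('q, 'd, 'm::finite) metric_manifold"
  assumes M: "semi_riemannian M" and N: "semi_riemannian N"
    and f: "smooth_function M f" "\<And>p. f p > 0"
  shows "semi_riemannian (warped_product M f N)"
proof -
  let ?W = "warped_product M f N"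
  note mm = semi_riemannian_manifold[OF M] and nm = semi_riemannian_manifold[OF N]
  have W: "smooth_manifold ?W" by (rule smooth_manifold_warped_product[OF mm nm])
  have "smooth_on (chart_image ?W (a, b)) (\<lambda>z. metric_tensor ?W (a, b) z $ k $ l)"
    if ab: "a \<in> chart_ix M" "b \<in> chart_ix N" for a b k l
  proof -
    have S: "open (chart_image M a)" "open (chart_image N b)"
      using open_chart_image[OF mm ab(1)] open_chart_image[OF nm ab(2)] by auto
    note R = open_vec_product[OF S]
    have g: "smooth_on {z. vec_left z \<in> chart_image M a \<and> vec_right z \<in> chart_image N b}
        (\<lambda>z. metric_tensor M a (vec_left z) $ i $ j)" for i j
      by (rule smooth_on_vec_left[OF smooth_metric_tensor[OF M ab(1)] S(1) R]) auto
    have "smooth_on {z. vec_left z \<in> chart_image M a \<and> vec_right z \<in> chart_image N b}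
        (\<lambda>z. (f \<circ> chart_inv M a) (vec_left z))"
      using f(1) ab(1) by (intro smooth_on_vec_left[OF _ S(1) R]) (auto simp: o_def smooth_function_def)
    moreover have "smooth_on {z. vec_left z \<in> chart_image M a \<and> vec_right z \<in> chart_image N b}
        (\<lambda>z. metric_tensor N b (vec_right z) $ i $ j)" for i j
      by (rule smooth_on_vec_right[OF smooth_metric_tensor[OF N ab(2)] S(2) R]) auto
    ultimately have "smooth_on {z. vec_left z \<in> chart_image M a \<and> vec_right z \<in> chart_image N b}
        (\<lambda>z. (f (chart_inv M a (vec_left z)))\<^sup>2 * metric_tensor N b (vec_right z) $ i $ j)" for i j
      unfolding power2_eq_square o_def by (intro smooth_on_mult R)
    then show ?thesis
      using g by (cases k; cases l) (simp_all add: chart_image_warped_product smooth_on_const)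
  qed
  moreover have "metric_tensor ?W (a, b) z =
      transpose J ** metric_tensor ?W (a', b') (transition ?W (a, b) (a', b') z) ** J"
    if ab: "a \<in> chart_ix M" "b \<in> chart_ix N" and ab': "a' \<in> chart_ix M" "b' \<in> chart_ix N"
      and z: "z \<in> overlap ?W (a, b) (a', b')"
      and J: "J = matrix (frechet_derivative (transition ?W (a, b) (a', b')) (at z))" for a b a' b' z J
  proof -
    let ?v = "transition M a a'" and ?w = "transition N b b'"
    have zl: "vec_left z \<in> overlap M a a'" and zr: "vec_right z \<in> overlap N b b'"
      using z by (auto simp: overlap_warped_product)
    define D1 where "D1 = frechet_derivative ?v (at (vec_left z))"
    define D2 where "D2 = frechet_derivative ?w (at (vec_right z))"
    have d1: "(?v has_derivative D1) (at (vec_left z))"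
      unfolding D1_def by (rule smooth_on_has_derivative[OF smooth_transition[OF mm ab(1) ab'(1)] zl])
    have d2: "(?w has_derivative D2) (at (vec_right z))"
      unfolding D2_def by (rule smooth_on_has_derivative[OF smooth_transition[OF nm ab(2) ab'(2)] zr])
    have "((\<lambda>z. vec_join (?v (vec_left z)) (?w (vec_right z))) has_derivative
        (\<lambda>d. vec_join (D1 (vec_left d)) (D2 (vec_right d)))) (at z)"
      unfolding vec_join_eq_add[of "?v _" "?w _"] vec_join_eq_add[of "D1 _" "D2 _"]
      by (intro has_derivative_add
          bounded_linear.has_derivative[OF bounded_linear_vec_join_left] bounded_linear.has_derivative[OF bounded_linear_vec_join_right]
          has_derivative_compose[OF bounded_linear_imp_has_derivative[OF bounded_linear_vec_left] d1]
          has_derivative_compose[OF bounded_linear_imp_has_derivative[OF bounded_linear_vec_right] d2])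
    moreover have tr: "transition ?W (a, b) (a', b') z' = vec_join (?v (vec_left z')) (?w (vec_right z'))"
      if "z' \<in> overlap ?W (a, b) (a', b')" for z'
      using subsetD[OF overlap_subset that] by (intro transition_warped_product mm nm ab)
    moreover have "open (overlap ?W (a, b) (a', b'))"
      using ab ab' by (intro open_overlap W) auto
    ultimately have "(transition ?W (a, b) (a', b') has_derivative
        (\<lambda>d. vec_join (D1 (vec_left d)) (D2 (vec_right d)))) (at z)"
      using z by (auto intro: has_derivative_transform_within_open)
    then have "J = matrix (\<lambda>d. vec_join (D1 (vec_left d)) (D2 (vec_right d)))"
      unfolding J by (simp flip: frechet_derivative_at)
    also have "\<dots> = block_diag (matrix D1) (matrix D2)"
      using linear_0[OF has_derivative_linear[OF d1]] linear_0[OF has_derivative_linear[OF d2]]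
      by (simp add: vec_sum_eq_iff matrix_def)
    finally have J': "J = block_diag (matrix D1) (matrix D2)" .
    show ?thesis
      using metric_tensor_transition[OF M ab(1) ab'(1) zl refl] metric_tensor_transition[OF N ab(2) ab'(2) zr refl]
      by (simp add: J' tr[OF z] transpose_block_diag block_diag_mult scaleR_congruence
          transition_overlap(1)[OF mm ab(1) ab'(1) zl] D1_def D2_def)
  qed
  moreover have "transpose (metric_tensor ?W (a, b) z) = metric_tensor ?W (a, b) z \<and>
      invertible (metric_tensor ?W (a, b) z)"
    if ab: "a \<in> chart_ix M" "b \<in> chart_ix N" and z: "z \<in> chart_image ?W (a, b)" for a b z
  proof -
    have z': "vec_left z \<in> chart_image M a" "vec_right z \<in> chart_image N b"
      using z by (auto simp: chart_image_warped_product)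
    have "transpose (c *\<^sub>R X) = c *\<^sub>R transpose X" for c and X :: "real^'m^'m"
      by (simp add: transpose_def vec_eq_iff)
    moreover have "(f (chart_inv M a (vec_left z)))\<^sup>2 \<noteq> 0" using f(2)[of "chart_inv M a (vec_left z)"] by simp
    ultimately show ?thesis
      using transpose_metric_tensor[OF M ab(1) z'(1)] transpose_metric_tensor[OF N ab(2) z'(2)]
        invertible_metric_tensor[OF M ab(1) z'(1)] invertible_metric_tensor[OF N ab(2) z'(2)]
      by (simp add: transpose_block_diag invertible_block_diag invertible_scaleR)
  qed
  moreover have "\<exists>q. \<forall>a\<in>chart_ix M. \<forall>b\<in>chart_ix N. \<forall>z\<in>chart_image ?W (a, b). has_index (metric_tensor ?W (a, b) z) q"
  proof -
    obtain p where p: "\<And>a y. a \<in> chart_ix M \<Longrightarrow> y \<in> chart_image M a \<Longrightarrow> has_index (metric_tensor M a y) p"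
      using index_metric_tensor[OF M] by blast
    obtain q where q: "\<And>b y. b \<in> chart_ix N \<Longrightarrow> y \<in> chart_image N b \<Longrightarrow> has_index (metric_tensor N b y) q"
      using index_metric_tensor[OF N] by blast
    have "(f x)\<^sup>2 > 0" for x using f(2)[of x] by simp
    then show ?thesis
      by (intro exI[of _ "p + q"]) (auto simp: chart_image_warped_product intro!: has_index_block_diag has_index_scaleR p q)
  qed
  ultimately show ?thesis
    using W unfolding semi_riemannian_def Let_def warped_product_fields(2) split_paired_Ball_Sigma split_paired_All
    by blast
qed

lemma smooth_function_warped_product_base:
  assumes M: "smooth_manifold M" and N: "smooth_manifold N" and h: "smooth_function M h"
  shows "smooth_function (warped_product M f N) (\<lambda>(p, q). h p)"
proof -
  have "smooth_on (chart_image (warped_product M f N) (a, b)) ((\<lambda>(p, q). h p) \<circ> chart_inv (warped_product M f N) (a, b))"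
    if ab: "a \<in> chart_ix M" "b \<in> chart_ix N" for a b
  proof -
    have S: "open (chart_image M a)" "open (chart_image N b)"
      using open_chart_image[OF M ab(1)] open_chart_image[OF N ab(2)] by auto
    have R: "open (chart_image (warped_product M f N) (a, b))"
      using open_vec_product[OF S] by (simp add: chart_image_warped_product)
    have "smooth_on (chart_image (warped_product M f N) (a, b)) (\<lambda>z. (h \<circ> chart_inv M a) (vec_left z))"
      using h ab(1) by (intro smooth_on_vec_left[OF _ S(1) R]) (auto simp: o_def smooth_function_def chart_image_warped_product)
    then show ?thesis
      by (subst smooth_on_cong[OF R, where v = "\<lambda>z. (h \<circ> chart_inv M a) (vec_left z)"])
        (simp_all add: chart_inv_warped_product[OF M ab(1) N ab(2)])
  qed
  then show ?thesis by (auto simp: smooth_function_def)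
qed

section \<open>The soliton equation\<close>

text \<open>Division by \<open>u\<^sup>2\<close> turns the equation into \<open>(h'/u)' = 0\<close>; the constant \<open>c\<close> is the value of
  \<open>h'/u\<close>.\<close>

lemma deriv_proportional_iff:
  fixes h u :: "real \<Rightarrow> real"
  assumes h: "smooth_on UNIV h" and u: "smooth_on UNIV u" "\<And>t. u t \<noteq> 0"
  shows "(\<forall>t. u t * deriv (deriv h) t = deriv u t * deriv h t)
    \<longleftrightarrow> (\<exists>c. \<forall>t. (h has_real_derivative c * u t) (at t))"
proof
  assume ode: "\<forall>t. u t * deriv (deriv h) t = deriv u t * deriv h t"
  have "((\<lambda>t. deriv h t / u t) has_real_derivative
      (deriv (deriv h) t * u t - deriv h t * deriv u t) / (u t * u t)) (at t)" for t
    by (rule DERIV_divide[OF has_real_derivative_smooth[OF smooth_deriv[OF h]]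
          has_real_derivative_smooth[OF u(1)] u(2)])
  moreover have "deriv (deriv h) t * u t - deriv h t * deriv u t = 0" for t
    using ode[rule_format, of t] by (simp add: mult.commute)
  ultimately have "((\<lambda>t. deriv h t / u t) has_real_derivative 0) (at t)" for t
    by simp
  then have "deriv h t / u t = deriv h 0 / u 0" for t
    using DERIV_isconst_all[of "\<lambda>t. deriv h t / u t"] by blast
  then have "deriv h t = deriv h 0 / u 0 * u t" for t
    using u(2)[of t] by (metis nonzero_divide_eq_eq)
  then show "\<exists>c. \<forall>t. (h has_real_derivative c * u t) (at t)"
    using has_real_derivative_smooth[OF h] by metis
next
  assume "\<exists>c. \<forall>t. (h has_real_derivative c * u t) (at t)"
  then obtain c where c: "\<And>t. (h has_real_derivative c * u t) (at t)" by blast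
  have d: "deriv h = (\<lambda>t. c * u t)" using DERIV_imp_deriv[OF c] by blast
  have "deriv (deriv h) t = c * deriv u t" for t
    unfolding d by (intro DERIV_imp_deriv DERIV_cmult has_real_derivative_smooth[OF u(1)])
  then show "\<forall>t. u t * deriv (deriv h) t = deriv u t * deriv h t" by (simp add: d)
qed

theorem theorem1p10:
  fixes \<epsilon> \<alpha> :: "real^'n::finite"
    and \<xi> f \<phi> h :: "real^'n \<Rightarrow> real"
    and f1 \<phi>1 h1 :: "real \<Rightarrow> real"
    and F :: "('p, 'c, 'm::finite) metric_manifold"
  assumes "3 \<le> CARD('n)"
    and "\<forall>i. \<epsilon> $ i \<in> {-1, 1}"
    and "\<alpha> \<noteq> 0"
    and "(\<Sum>k\<in>UNIV. \<epsilon> $ k * (\<alpha> $ k)\<^sup>2) = 0"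
    and "\<forall>x. \<xi> x = (\<Sum>k\<in>UNIV. \<alpha> $ k * x $ k)"
    and "smooth_on UNIV f" and "smooth_on UNIV \<phi>" and "smooth_on UNIV h"
    and "\<forall>x. f x > 0" and "\<forall>x. \<phi> x \<noteq> 0"
    and "\<forall>x. f x = f1 (\<xi> x)" and "\<forall>x. \<phi> x = \<phi>1 (\<xi> x)" and "\<forall>x. h x = h1 (\<xi> x)"
    and "semi_riemannian F" and "scalar_flat F"
  shows "steady_gradient_yamabe_soliton
           (warped_product (conformal_metric (\<lambda>x. 1 / (\<phi> x)\<^sup>2) (pseudo_euclidean \<epsilon>)) f F)
           (\<lambda>(x, p). h x)
         \<longleftrightarrow> (\<exists>c. \<forall>t. (h1 has_real_derivative c / (\<phi>1 t)\<^sup>2) (at t))"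
proof -
  note eps = assms(2) and \<alpha> = assms(3) and null = assms(4)
    and f = assms(6) assms(9) and \<phi> = assms(7) assms(10) and F = assms(14) and flat = assms(15)
  define v where "v = (\<lambda>x. 1 / (\<phi> x)\<^sup>2)"
  define E where "E = conformal_metric v (pseudo_euclidean \<epsilon>)"
  let ?W = "warped_product E f F"
  have \<xi>: "\<xi> x = \<alpha> \<bullet> x" for x using assms(5) by (simp add: inner_vec_def)

  \<comment> \<open>On the line spanned by \<open>e\<close> the function \<open>\<xi>\<close> is the parameter, so the one-variable profiles are
    restrictions of functions on the whole space to this line and inherit their smoothness.\<close>
  define e where "e = (1 / (\<alpha> \<bullet> \<alpha>)) *\<^sub>R \<alpha>"
  have \<xi>_e: "\<alpha> \<bullet> (t *\<^sub>R e) = t" for t using \<alpha> by (simp add: e_def)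
  have profile: "g = (\<lambda>t. k (t *\<^sub>R e))" "smooth_on UNIV g"
    if "\<forall>x. k x = g (\<xi> x)" "smooth_on UNIV k" for g :: "real \<Rightarrow> real" and k
  proof -
    show g: "g = (\<lambda>t. k (t *\<^sub>R e))" by (simp only: that(1)[rule_format] \<xi> \<xi>_e)
    show "smooth_on UNIV g"
      unfolding g by (rule smooth_on_compose_linear[OF bounded_linear_scaleR_left open_UNIV that(2)]) auto
  qed
  note f1 = profile[OF assms(11,6)] and \<phi>1 = profile[OF assms(12,7)] and h1 = profile[OF assms(13,8)]
  define u where "u = (\<lambda>t. inverse (\<phi>1 t * \<phi>1 t))"
  define w where "w = (\<lambda>t. f1 t * f1 t)"
  have nz: "f1 t \<noteq> 0" "\<phi>1 t \<noteq> 0" for t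
    using f(2)[rule_format, of "t *\<^sub>R e"] \<phi>(2) unfolding f1(1) \<phi>1(1) by auto
  have u: "smooth_on UNIV u" "u t \<noteq> 0" and w: "smooth_on UNIV w" "w t \<noteq> 0" for t
    using nz unfolding u_def w_def by (auto intro!: smooth_on_inverse smooth_on_mult f1(2) \<phi>1(2))

  have v_u: "v x = u (\<alpha> \<bullet> x)" for x
    using assms(12) by (simp add: v_def u_def \<xi> power2_eq_square inverse_eq_divide)
  have f_w: "(f x)\<^sup>2 = w (\<alpha> \<bullet> x)" for x
    using assms(11) by (simp add: w_def \<xi> power2_eq_square)
  have inv_E: "chart_inv E a = (\<lambda>y. y)" "chart_image E a = UNIV" for a
    using chart_inv_pseudo_euclidean[of \<epsilon> a]
    by (simp_all add: E_def conformal_metric_def chart_inv_def chart_image_def pseudo_euclidean_def)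
  have ix_E: "chart_ix E = UNIV"
    and g_E: "metric_tensor E a y = v y *\<^sub>R diag_matrix \<epsilon>" for a y
    using chart_inv_pseudo_euclidean[of \<epsilon> a] by (simp_all add: E_def conformal_metric_def pseudo_euclidean_def)
  have smooth_E: "smooth_function E k" if "smooth_on UNIV k" for k
    using that by (simp add: smooth_function_def inv_E o_def)
  have "smooth_on UNIV v"
    unfolding v_def power2_eq_square divide_inverse mult_1
    using \<phi> by (intro smooth_on_inverse smooth_on_mult) auto
  then have E: "semi_riemannian E"
    unfolding E_def using \<phi>(2)
    by (intro semi_riemannian_conformal_metric semi_riemannian_pseudo_euclidean
        smooth_function_pseudo_euclidean eps) (auto simp: v_def)
  have W: "semi_riemannian ?W"
    using f(2) by (intro semi_riemannian_warped_product E F smooth_E f(1)) auto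
  have H: "smooth_function ?W (\<lambda>(x, p). h x)"
    by (intro smooth_function_warped_product_base semi_riemannian_manifold E F smooth_E assms(8))

  \<comment> \<open>In a product chart the metric is the one of the locale, its scalar curvature is zero, and the
    soliton equation at \<open>z\<close> is the differential equation for \<open>h1\<close> at the value of \<open>\<xi>\<close>.\<close>
  have chart: "(\<forall>k l. (scalar_curv (metric_tensor ?W (a, b)) z - 0) * metric_tensor ?W (a, b) z $ k $ l
        = hessian (metric_tensor ?W (a, b)) ((\<lambda>(x, p). h x) \<circ> chart_inv ?W (a, b)) k l z)
      \<longleftrightarrow> u (\<alpha> \<bullet> vec_left z) * deriv (deriv h1) (\<alpha> \<bullet> vec_left z)
        = deriv u (\<alpha> \<bullet> vec_left z) * deriv h1 (\<alpha> \<bullet> vec_left z)"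
    if b: "b \<in> chart_ix F" and z: "z \<in> chart_image ?W (a, b)" for a b z
  proof -
    have open_b: "open (chart_image F b)"
      by (rule open_chart_image[OF semi_riemannian_manifold[OF F] b])
    interpret null_warped \<epsilon> \<alpha> u w "metric_tensor F b" "chart_image F b"
    proof
      show "\<epsilon> $ i * \<epsilon> $ i = 1" for i using eps[rule_format, of i] by auto
      show "metric_tensor F b y $ i $ j = metric_tensor F b y $ j $ i" if "y \<in> chart_image F b" for y i j
        using arg_cong[OF transpose_metric_tensor[OF F b that], of "\<lambda>X. X $ j $ i"] by (simp add: transpose_def)
    qed (use null u w open_b smooth_metric_tensor[OF F b] invertible_metric_tensor[OF F b] in auto)
    have G: "metric_tensor ?W (a, b) = G"
      by (simp add: fun_eq_iff G_def g_E inv_E v_u f_w)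
    have V: "chart_image ?W (a, b) = V"
      by (simp add: chart_image_warped_product inv_E V_def)
    have "((\<lambda>(x, p). h x) \<circ> chart_inv ?W (a, b)) z' = h1 (\<alpha> \<bullet> vec_left z')" if "z' \<in> V" for z'
      using that assms(13) ix_E unfolding V[symmetric]
      by (simp add: chart_inv_warped_product[OF semi_riemannian_manifold[OF E] _ semi_riemannian_manifold[OF F] b] inv_E \<xi>)
    then have "hessian G ((\<lambda>(x, p). h x) \<circ> chart_inv ?W (a, b)) k l z = hessian G (\<lambda>z. h1 (\<alpha> \<bullet> vec_left z)) k l z" for k l
      using z unfolding V by (intro hessian_cong[OF open_V])
    moreover have "scalar_curv G z = 0"
      using scalar_curv_G[of z] z flat b unfolding V by (simp add: scalar_flat_def V_def)
    ultimately show ?thesis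
      using hessian_G_eq_0_iff[OF \<alpha> _ h1(2), of z] z unfolding V G by (simp add: eq_commute[of 0])
  qed

  have "steady_gradient_yamabe_soliton ?W (\<lambda>(x, p). h x)
      \<longleftrightarrow> (\<forall>b\<in>chart_ix F. \<forall>z\<in>chart_image ?W ((), b). u (\<alpha> \<bullet> vec_left z) * deriv (deriv h1) (\<alpha> \<bullet> vec_left z)
        = deriv u (\<alpha> \<bullet> vec_left z) * deriv h1 (\<alpha> \<bullet> vec_left z))"
    unfolding steady_gradient_yamabe_soliton_def gradient_yamabe_soliton_def warped_product_fields(2) ix_E
    using W H chart by auto
  also have "\<dots> \<longleftrightarrow> (\<forall>t. u t * deriv (deriv h1) t = deriv u t * deriv h1 t)"
  proof
    assume *: "\<forall>b\<in>chart_ix F. \<forall>z\<in>chart_image ?W ((), b). u (\<alpha> \<bullet> vec_left z) * deriv (deriv h1) (\<alpha> \<bullet> vec_left z)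
        = deriv u (\<alpha> \<bullet> vec_left z) * deriv h1 (\<alpha> \<bullet> vec_left z)"
    \<comment> \<open>The fibre has a point, and over it the base coordinates are arbitrary; so \<open>\<xi>\<close> attains every \<open>t\<close>.\<close>
    obtain b p where b: "b \<in> chart_ix F" "p \<in> chart_dom F b"
      using semi_riemannian_manifold[OF F] unfolding smooth_manifold_def by blast
    show "\<forall>t. u t * deriv (deriv h1) t = deriv u t * deriv h1 t"
    proof
      fix t
      have "vec_join (t *\<^sub>R e) (chart_map F b p) \<in> chart_image ?W ((), b)"
        using b(2) by (simp add: chart_image_warped_product inv_E) (simp add: chart_image_def)
      with *[rule_format, OF b(1) this] show "u t * deriv (deriv h1) t = deriv u t * deriv h1 t"
        by (simp only: vec_left_join \<xi>_e)
    qed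
  qed auto
  also have "\<dots> \<longleftrightarrow> (\<exists>c. \<forall>t. (h1 has_real_derivative c * u t) (at t))"
    by (rule deriv_proportional_iff[OF h1(2) u])
  finally show ?thesis
    by (simp only: E_def v_def u_def power2_eq_square divide_inverse)
qed

end
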